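(* Let $\tau\in(0,(1+\sqrt5)/2)$ and $\sigma>0$, let the self-adjoint (possibly indefinite) linear operators $\mathcal S:\mathcal Y\to\mathcal Y$ and $\mathcal T:\mathcal Z\to\mathcal Z$ satisfy $$\mathcal S\succeq-\tfrac12\widehat\Sigma_f,\qquad \mathcal T\succeq-\tfrac12\widehat\Sigma_g,$$ and $$\tfrac12\widehat\Sigma_f+\mathcal S+\sigma\mathcal A\mathcal A^*\succ0,\qquad \tfrac12\widehat\Sigma_g+\mathcal T+\sigma\mathcal B\mathcal B^*\succ0,$$ and let $\{u^k:=(y^k,z^k,x^k)\}$ be an infinite sequence generated by the majorized iPADMM. Then: (a) The sequence $\{(y^k,z^k)\}$ converges to an optimal solution of problem (P) and $\{x^k\}$ converges to an optimal solution of the dual of problem (P). (b) Suppose that the sequence $\{(y^k,z^k,x^k)\}$ converges to a KKT point $\bar u:=(\bar y,\bar z,\bar x)\in\overline\Omega$ and that the KKT mapping $\mathcal R$ is metrically subregular at $(\bar u,0)\in\mathrm{gph}\,\mathcal R$ with modulus $\eta>0$. Then there exist a number $\mu\in(0,1)$ and an integer $k_0\ge1$ such that for all $k\ge k_0$, $$\mathrm{dist}_{\mathcal M}^2(u^{k+1},\overline\Omega)+\|z^{k+1}-z^k\|^2_{\widehat\Sigma_g+\mathcal T}\le\mu\left[\mathrm{dist}_{\mathcal M}^2(u^k,\overline\Omega)+\|z^k-z^{k-1}\|^2_{\widehat\Sigma_g+\mathcal T}\right].$$ Moreover, there exists a number $\hat\mu\in[\mu,1)$ such that for all $k\ge1$,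 $$\mathrm{dist}_{\mathcal M}^2(u^{k+1},\overline\Omega)+\|z^{k+1}-z^k\|^2_{\widehat\Sigma_g+\mathcal T}\le\hat\mu\left[\mathrm{dist}_{\mathcal M}^2(u^k,\overline\Omega)+\|z^k-z^{k-1}\|^2_{\widehat\Sigma_g+\mathcal T}\right].$$
   Context: **Problem.** $\mathcal X,\mathcal Y,\mathcal Z$ are finite dimensional Euclidean spaces. Problem (P) is $$\min_{y\in\mathcal Y,\,z\in\mathcal Z}\ p(y)+f(y)+q(z)+g(z)\quad\text{s.t.}\quad \mathcal A^*y+\mathcal B^*z=c,$$ where $f:\mathcal Y\to\mathbb R$ and $g:\mathcal Z\to\mathbb R$ are convex and differentiable with Lipschitz continuous gradients, $p:\mathcal Y\to(-\infty,+\infty]$ and $q:\mathcal Z\to(-\infty,+\infty]$ are closed proper convex functions, $\mathcal A^*:\mathcal Y\to\mathcal X$ and $\mathcal B^*:\mathcal Z\to\mathcal X$ are the adjoints of linear operators $\mathcal A:\mathcal X\to\mathcal Y$ and $\mathcal B:\mathcal X\to\mathcal Z$, and $c\in\mathcal X$. The dual of (P) is $\max_{x\in\mathcal X}\inf_{y,z}\{p(y)+f(y)+q(z)+g(z)+\langle x,\mathcal A^*y+\mathcal B^*z-c\rangle\}$. **Notation.** For a self-adjoint (not necessarily semidefinite) linear operator $\mathcal G$, $\|x\|_{\mathcal G}^2:=\langle x,\mathcal Gx\rangle$; $\succeq,\succ$ denote the positive (semi)definite order. $\mathcal I$ is the identity. **Majorization.** $\widehat\Sigma_f,\widehat\Sigma_g$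 are fixed self-adjoint positive semidefinite linear operators such that for all $y,y'\in\mathcal Y$ and $z,z'\in\mathcal Z$, $f(y)\le f(y')+\langle\nabla f(y'),y-y'\rangle+\frac12\|y-y'\|^2_{\widehat\Sigma_f}$ and $g(z)\le g(z')+\langle\nabla g(z'),z-z'\rangle+\frac12\|z-z'\|^2_{\widehat\Sigma_g}$. **Majorized iPADMM.** Given $\sigma>0$, $\tau>0$, self-adjoint $\mathcal S,\mathcal T$ and a starting point $(y^0,z^0,x^0)\in\mathrm{dom}\,p\times\mathrm{dom}\,q\times\mathcal X$, for $k=0,1,2,\dots$: $$y^{k+1}\in\arg\min_{y}\ p(y)+\langle y,\nabla f(y^k)+\mathcal Ax^k\rangle+\tfrac\sigma2\|\mathcal A^*y+\mathcal B^*z^k-c\|^2+\tfrac12\|y-y^k\|^2_{\widehat\Sigma_f+\mathcal S},$$ $$z^{k+1}\in\arg\min_{z}\ q(z)+\langle z,\nabla g(z^k)+\mathcal Bx^k\rangle+\tfrac\sigma2\|\mathcal A^*y^{k+1}+\mathcal B^*z-c\|^2+\tfrac12\|z-z^k\|^2_{\widehat\Sigma_g+\mathcal T},$$ $$x^{k+1}=x^k+\tau\sigma(\mathcal A^*y^{k+1}+\mathcal B^*z^{k+1}-c).$$ **KKT system.** $(y,z,x)$ is a KKT point if $0\in\partial p(y)+\nabla f(y)+\mathcal Ax$, $0\in\partial q(z)+\nabla g(z)+\mathcal Bx$, $\mathcal A^*y+\mathcal B^*z=c$. $\overline\Omega\subset\mathcal U:=\mathcal Y\times\mathcal Z\times\mathcal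 X$ is the set of KKT points. Standing assumption: $\overline\Omega\ne\emptyset$. **KKT mapping.** With $\mathrm{Pr}_\theta(v):=\arg\min_{v'}\{\theta(v')+\frac12\|v'-v\|^2\}$, for $u=(y,z,x)$, $$\mathcal R(u):=\big(y-\mathrm{Pr}_p[y-(\nabla f(y)+\mathcal Ax)],\ z-\mathrm{Pr}_q[z-(\nabla g(z)+\mathcal Bx)],\ c-\mathcal A^*y-\mathcal B^*z\big).$$ One has $u\in\overline\Omega$ iff $\mathcal R(u)=0$. $\mathcal R$ is metrically subregular at $(\bar u,0)\in\mathrm{gph}\,\mathcal R$ with modulus $\eta>0$ if there is $\rho>0$ with $\mathrm{dist}(u,\overline\Omega)\le\eta\|\mathcal R(u)\|$ for all $u$ with $\|u-\bar u\|\le\rho$. **Operator $\mathcal M$.** Let $s_\tau:=\frac{5-\tau-3\min(\tau,\tau^{-1})}{4}$, let $\mathcal E:\mathcal X\to\mathcal U$ be the linear operator with adjoint $\mathcal E^*(y,z,x)=\mathcal A^*y+\mathcal B^*z$, and $$\mathcal M:=\mathrm{Diag}\big(\widehat\Sigma_f+\mathcal S,\ \widehat\Sigma_g+\mathcal T+\sigma\mathcal B\mathcal B^*,\ (\tau\sigma)^{-1}\mathcal I\big)+s_\tau\sigma\mathcal E\mathcal E^*.$$ $\mathrm{dist}_{\mathcal M}(u,\overline\Omega):=\inf_{u'\in\overline\Omega}\|u-u'\|_{\mathcal M}$. *)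

theory Defs
  imports "HOL-Analysis.Analysis"
begin

definition self_adjoint :: "('a::euclidean_space \<Rightarrow> 'a) \<Rightarrow> bool" where
  "self_adjoint G \<longleftrightarrow> linear G \<and> adjoint G = G"

definition psd :: "('a::euclidean_space \<Rightarrow> 'a) \<Rightarrow> bool" where
  "psd G \<longleftrightarrow> self_adjoint G \<and> (\<forall>v. 0 \<le> v \<bullet> G v)"

definition posdef :: "('a::euclidean_space \<Rightarrow> 'a) \<Rightarrow> bool" where
  "posdef G \<longleftrightarrow> self_adjoint G \<and> (\<forall>v. v \<noteq> 0 \<longrightarrow> 0 < v \<bullet> G v)"

definition loewner_ge :: "('a::euclidean_space \<Rightarrow> 'a) \<Rightarrow> ('a \<Rightarrow> 'a) \<Rightarrow> bool"
    (infix \<open>\<succeq>\<^sub>L\<close> 50) where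
  "G \<succeq>\<^sub>L H \<longleftrightarrow> psd (\<lambda>v. G v - H v)"

definition loewner_gt :: "('a::euclidean_space \<Rightarrow> 'a) \<Rightarrow> ('a \<Rightarrow> 'a) \<Rightarrow> bool"
    (infix \<open>\<succ>\<^sub>L\<close> 50) where
  "G \<succ>\<^sub>L H \<longleftrightarrow> posdef (\<lambda>v. G v - H v)"

(* The squared "G-norm", which may be negative when G is indefinite. *)
definition sqnorm :: "('a::euclidean_space \<Rightarrow> 'a) \<Rightarrow> 'a \<Rightarrow> real" where
  "sqnorm G v = v \<bullet> G v"

(* Meaningful only where f is differentiable; the gradient is then unique. *)
definition grad :: "('a::euclidean_space \<Rightarrow> real) \<Rightarrow> 'a \<Rightarrow> 'a" where
  "grad f y = (THE D. GDERIV f y :> D)"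

definition ereal_epigraph :: "('a \<Rightarrow> ereal) \<Rightarrow> ('a \<times> real) set" where
  "ereal_epigraph \<theta> = {(v, r). \<theta> v \<le> ereal r}"

definition edom :: "('a \<Rightarrow> ereal) \<Rightarrow> 'a set" where
  "edom \<theta> = {v. \<theta> v < \<infinity>}"

definition closed_proper_convex :: "('a::euclidean_space \<Rightarrow> ereal) \<Rightarrow> bool" where
  "closed_proper_convex \<theta> \<longleftrightarrow>
     closed (ereal_epigraph \<theta>) \<and> convex (ereal_epigraph \<theta>) \<and>
     (\<forall>v. \<theta> v \<noteq> -\<infinity>) \<and> edom \<theta> \<noteq> {}"

definition subdiff :: "('a::euclidean_space \<Rightarrow> ereal) \<Rightarrow> 'a \<Rightarrow> 'a set" where
  "subdiff \<theta> v = {s. \<forall>v'. \<theta> v + ereal (s \<bullet> (v' - v)) \<le> \<theta> v'}"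

(* For closed proper convex \<theta> the minimizer exists and is unique, so arg_min makes no
   genuine choice. *)
definition prox :: "('a::euclidean_space \<Rightarrow> ereal) \<Rightarrow> 'a \<Rightarrow> 'a" where
  "prox \<theta> v = arg_min (\<lambda>v'. \<theta> v' + ereal (1/2 * (norm (v' - v))\<^sup>2)) (\<lambda>_. True)"

definition objective ::
  "('y \<Rightarrow> ereal) \<Rightarrow> ('y \<Rightarrow> real) \<Rightarrow> ('z \<Rightarrow> ereal) \<Rightarrow> ('z \<Rightarrow> real) \<Rightarrow> 'y \<times> 'z \<Rightarrow> ereal" where
  "objective p f q g = (\<lambda>(y, z). p y + ereal (f y) + q z + ereal (g z))"

definition feasible ::
  "('x::euclidean_space \<Rightarrow> 'y::euclidean_space) \<Rightarrow> ('x \<Rightarrow> 'z::euclidean_space) \<Rightarrow> 'x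
     \<Rightarrow> 'y \<times> 'z \<Rightarrow> bool" where
  "feasible A B c = (\<lambda>(y, z). adjoint A y + adjoint B z = c)"

definition primal_optimal where
  "primal_optimal p f q g A B c yz \<longleftrightarrow> is_arg_min (objective p f q g) (feasible A B c) yz"

definition dual_objective ::
  "('y::euclidean_space \<Rightarrow> ereal) \<Rightarrow> ('y \<Rightarrow> real) \<Rightarrow> ('z::euclidean_space \<Rightarrow> ereal) \<Rightarrow> ('z \<Rightarrow> real)
     \<Rightarrow> ('x::euclidean_space \<Rightarrow> 'y) \<Rightarrow> ('x \<Rightarrow> 'z) \<Rightarrow> 'x \<Rightarrow> 'x \<Rightarrow> ereal" where
  "dual_objective p f q g A B c x =
     (INF (y, z) \<in> UNIV. objective p f q g (y, z) + ereal (x \<bullet> (adjoint A y + adjoint B z - c)))"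

definition dual_optimal where
  "dual_optimal p f q g A B c x \<longleftrightarrow> is_arg_max (dual_objective p f q g A B c) (\<lambda>_. True) x"

definition KKT_points ::
  "('y::euclidean_space \<Rightarrow> ereal) \<Rightarrow> ('y \<Rightarrow> real) \<Rightarrow> ('z::euclidean_space \<Rightarrow> ereal) \<Rightarrow> ('z \<Rightarrow> real)
     \<Rightarrow> ('x::euclidean_space \<Rightarrow> 'y) \<Rightarrow> ('x \<Rightarrow> 'z) \<Rightarrow> 'x \<Rightarrow> ('y \<times> 'z \<times> 'x) set" where
  "KKT_points p f q g A B c =
     {(y, z, x). 0 \<in> (\<lambda>v. v + grad f y + A x) ` subdiff p y \<and>
                 0 \<in> (\<lambda>w. w + grad g z + B x) ` subdiff q z \<and>
                 adjoint A y + adjoint B z = c}"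

definition KKT_map ::
  "('y::euclidean_space \<Rightarrow> ereal) \<Rightarrow> ('y \<Rightarrow> real) \<Rightarrow> ('z::euclidean_space \<Rightarrow> ereal) \<Rightarrow> ('z \<Rightarrow> real)
     \<Rightarrow> ('x::euclidean_space \<Rightarrow> 'y) \<Rightarrow> ('x \<Rightarrow> 'z) \<Rightarrow> 'x \<Rightarrow> 'y \<times> 'z \<times> 'x \<Rightarrow> 'y \<times> 'z \<times> 'x" where
  "KKT_map p f q g A B c = (\<lambda>(y, z, x).
     (y - prox p (y - (grad f y + A x)),
      z - prox q (z - (grad g z + B x)),
      c - adjoint A y - adjoint B z))"

(* Metric subregularity of the KKT mapping at (u, 0); the first conjunct says that
   (u, 0) lies in the graph. *)
definition KKT_map_subregular where
  "KKT_map_subregular p f q g A B c u \<eta> \<longleftrightarrow>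
     KKT_map p f q g A B c u = 0 \<and>
     (\<exists>\<rho>>0. \<forall>v. norm (v - u) \<le> \<rho> \<longrightarrow>
        infdist v (KKT_points p f q g A B c) \<le> \<eta> * norm (KKT_map p f q g A B c v))"

definition majorizes :: "('a::euclidean_space \<Rightarrow> 'a) \<Rightarrow> ('a \<Rightarrow> real) \<Rightarrow> bool" where
  "majorizes \<Sigma> f \<longleftrightarrow>
     (\<forall>y y'. f y \<le> f y' + grad f y' \<bullet> (y - y') + 1/2 * sqnorm \<Sigma> (y - y'))"

definition majorized_iPADMM ::
  "('y::euclidean_space \<Rightarrow> ereal) \<Rightarrow> ('y \<Rightarrow> real) \<Rightarrow> ('z::euclidean_space \<Rightarrow> ereal) \<Rightarrow> ('z \<Rightarrow> real)
     \<Rightarrow> ('x::euclidean_space \<Rightarrow> 'y) \<Rightarrow> ('x \<Rightarrow> 'z) \<Rightarrow> 'x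
     \<Rightarrow> ('y \<Rightarrow> 'y) \<Rightarrow> ('z \<Rightarrow> 'z) \<Rightarrow> ('y \<Rightarrow> 'y) \<Rightarrow> ('z \<Rightarrow> 'z) \<Rightarrow> real \<Rightarrow> real
     \<Rightarrow> (nat \<Rightarrow> 'y) \<Rightarrow> (nat \<Rightarrow> 'z) \<Rightarrow> (nat \<Rightarrow> 'x) \<Rightarrow> bool" where
  "majorized_iPADMM p f q g A B c \<Sigma>f \<Sigma>g S T \<sigma> \<tau> y z x \<longleftrightarrow>
     y 0 \<in> edom p \<and> z 0 \<in> edom q \<and>
     (\<forall>k.
        is_arg_min
          (\<lambda>v. p v + ereal (v \<bullet> (grad f (y k) + A (x k))
                 + \<sigma>/2 * (norm (adjoint A v + adjoint B (z k) - c))\<^sup>2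
                 + 1/2 * sqnorm (\<lambda>h. \<Sigma>f h + S h) (v - y k)))
          (\<lambda>_. True) (y (Suc k)) \<and>
        is_arg_min
          (\<lambda>w. q w + ereal (w \<bullet> (grad g (z k) + B (x k))
                 + \<sigma>/2 * (norm (adjoint A (y (Suc k)) + adjoint B w - c))\<^sup>2
                 + 1/2 * sqnorm (\<lambda>h. \<Sigma>g h + T h) (w - z k)))
          (\<lambda>_. True) (z (Suc k)) \<and>
        x (Suc k) = x k + (\<tau> * \<sigma>) *\<^sub>R (adjoint A (y (Suc k)) + adjoint B (z (Suc k)) - c))"

definition s_tau :: "real \<Rightarrow> real" where
  "s_tau \<tau> = (5 - \<tau> - 3 * min \<tau> (inverse \<tau>)) / 4"

definition Estar ::
  "('x::euclidean_space \<Rightarrow> 'y::euclidean_space) \<Rightarrow> ('x \<Rightarrow> 'z::euclidean_space)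
     \<Rightarrow> 'y \<times> 'z \<times> 'x \<Rightarrow> 'x" where
  "Estar A B = (\<lambda>(y, z, x). adjoint A y + adjoint B z)"

definition Emap ::
  "('x::euclidean_space \<Rightarrow> 'y::euclidean_space) \<Rightarrow> ('x \<Rightarrow> 'z::euclidean_space)
     \<Rightarrow> 'x \<Rightarrow> 'y \<times> 'z \<times> 'x" where
  "Emap A B = adjoint (Estar A B)"

definition Mop ::
  "('x::euclidean_space \<Rightarrow> 'y::euclidean_space) \<Rightarrow> ('x \<Rightarrow> 'z::euclidean_space)
     \<Rightarrow> ('y \<Rightarrow> 'y) \<Rightarrow> ('z \<Rightarrow> 'z) \<Rightarrow> ('y \<Rightarrow> 'y) \<Rightarrow> ('z \<Rightarrow> 'z) \<Rightarrow> real \<Rightarrow> real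
     \<Rightarrow> 'y \<times> 'z \<times> 'x \<Rightarrow> 'y \<times> 'z \<times> 'x" where
  "Mop A B \<Sigma>f \<Sigma>g S T \<sigma> \<tau> = (\<lambda>(y, z, x).
     (\<Sigma>f y + S y, \<Sigma>g z + T z + \<sigma> *\<^sub>R B (adjoint B z), inverse (\<tau> * \<sigma>) *\<^sub>R x)
     + (s_tau \<tau> * \<sigma>) *\<^sub>R Emap A B (Estar A B (y, z, x)))"

(* Only used for positive semidefinite G and nonempty K. *)
definition op_dist :: "('a::euclidean_space \<Rightarrow> 'a) \<Rightarrow> 'a \<Rightarrow> 'a set \<Rightarrow> real" where
  "op_dist G u K = (INF v\<in>K. sqrt (sqnorm G (u - v)))"

end

theory Submission
  imports Defs
begin

text \<open>
  Each subproblem of the algorithm yields a subgradient inclusion. Tested against a KKT point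
  \<open>v\<close>, with the majorization giving
  \<open>(grad f y - grad f v) \<bullet> (y' - v) \<ge> - sqnorm \<Sigma>f (y' - y) / 4\<close> for the next iterate \<open>y'\<close>, the two inclusions bound the decrease of a
  quadratic distance to \<open>v\<close> up to a cross term in \<open>z' - z\<close> and the new residual. Comparing two
  consecutive \<open>z\<close>-inclusions replaces the new residual by \<open>1 - \<tau>\<close> times the old one, and the
  constant \<open>s_tau \<tau>\<close> in \<open>Mop\<close> lies strictly between \<open>(1 - \<tau>)\<^sup>2\<close> and \<open>2 - \<tau>\<close> precisely for \<open>\<tau>\<close> below
  the golden ratio, which absorbs it. So \<open>sqnorm M (u - v)\<close> plus the weighted last \<open>z\<close>-increment
  decreases by a multiple of the squared step, uniformly in \<open>v\<close>.
  Cluster points are then KKT points and the decrease forces convergence. For the rate, the KKT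
  residual at the new iterate is bounded by the step, so subregularity bounds the next merit value by the
  squared step and the decrease becomes a contraction.
\<close>

section \<open>Subgradients, proximal points and majorized gradients\<close>

lemma nonpos_if_le_small_multiples:
  fixes a b :: real
  assumes "\<And>t. 0 < t \<Longrightarrow> t < 1 \<Longrightarrow> a \<le> t * b"
  shows "a \<le> 0"
proof (rule tendsto_lowerbound)
  show "((\<lambda>t. t * b) \<longlongrightarrow> 0) (at_right 0)"
    by (rule tendsto_eq_intros refl | simp)+
  show "\<forall>\<^sub>F t in at_right 0. a \<le> t * b"
    using eventually_at_right_real[OF zero_less_one] by (rule eventually_mono) (use assms in auto)
qed simp

lemma closed_proper_convex_not_MInf: "closed_proper_convex \<theta> \<Longrightarrow> \<theta> v \<noteq> -\<infinity>"
  by (simp add: closed_proper_convex_def)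

lemma closed_proper_convex_finite_point:
  assumes "closed_proper_convex \<theta>"
  obtains v r where "\<theta> v = ereal r"
proof -
  obtain v where "\<theta> v < \<infinity>"
    using assms by (auto simp: closed_proper_convex_def edom_def)
  with closed_proper_convex_not_MInf[OF assms, of v] show thesis
    by (cases "\<theta> v") (auto intro: that)
qed

lemma closed_proper_convex_combination:
  assumes "closed_proper_convex \<theta>" "\<theta> v = ereal r" "\<theta> w = ereal s" "0 \<le> t" "t \<le> 1"
  shows "\<theta> (v + t *\<^sub>R (w - v)) \<le> ereal (r + t * (s - r))"
proof -
  have "convex (ereal_epigraph \<theta>)" "(v, r) \<in> ereal_epigraph \<theta>" "(w, s) \<in> ereal_epigraph \<theta>"
    using assms by (auto simp: closed_proper_convex_def ereal_epigraph_def)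
  then have "(1 - t) *\<^sub>R (v, r) + t *\<^sub>R (w, s) \<in> ereal_epigraph \<theta>"
    using assms(4,5) unfolding convex_alt by blast
  then show ?thesis
    by (simp add: ereal_epigraph_def algebra_simps)
qed

lemma is_arg_min_le:
  fixes F :: "'a \<Rightarrow> 'b::linorder"
  shows "is_arg_min F (\<lambda>_. True) w \<Longrightarrow> F w \<le> F v"
  by (simp add: is_arg_min_def not_less)

text \<open>The minimizer is compared with points of the segment from \<open>w\<close> to
  \<open>v\<close>: convexity bounds \<theta> there and the quadratic bound controls
  \<open>h\<close>, so dividing by the segment parameter and sending it to 0 leaves the subgradient
  inequality. This one form serves both the subproblems and the proximal mapping.\<close>

lemma subdiff_of_is_arg_min:
  assumes \<theta>: "closed_proper_convex \<theta>"
    and min: "is_arg_min (\<lambda>v. \<theta> v + ereal (h v)) (\<lambda>_. True) w"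
    and h: "\<And>d. h (w + d) \<le> h w + G \<bullet> d + K * (norm d)\<^sup>2"
  shows "- G \<in> subdiff \<theta> w"
proof -
  obtain v1 r1 where v1: "\<theta> v1 = ereal r1"
    using \<theta> by (rule closed_proper_convex_finite_point)
  \<comment> \<open>Comparison with a point of finite value rules out an infinite value at the
    minimizer.\<close>
  have "\<theta> w + ereal (h w) \<le> \<theta> v1 + ereal (h v1)"
    using is_arg_min_le[OF min] .
  then obtain r where r: "\<theta> w = ereal r"
    using v1 closed_proper_convex_not_MInf[OF \<theta>, of w] by (cases "\<theta> w") auto
  have "\<theta> w + ereal (- G \<bullet> (v - w)) \<le> \<theta> v" for v
  proof (cases "\<theta> v")
    case (real s)
    define d where "d = v - w"
    have "r - s - G \<bullet> d \<le> t * (K * (norm d)\<^sup>2)" if t: "0 < t" "t < 1" for t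
    proof -
      have "\<theta> w + ereal (h w) \<le> \<theta> (w + t *\<^sub>R d) + ereal (h (w + t *\<^sub>R d))"
        using is_arg_min_le[OF min] .
      also have "\<dots> \<le> ereal (r + t * (s - r)) + ereal (h (w + t *\<^sub>R d))"
        using closed_proper_convex_combination[OF \<theta> r real] t
        by (intro add_mono) (auto simp: d_def)
      finally have "r + h w \<le> r + t * (s - r) + h (w + t *\<^sub>R d)"
        by (simp add: r)
      with h[of "t *\<^sub>R d"] t have "0 \<le> t * (s - r + G \<bullet> d + t * (K * (norm d)\<^sup>2))"
        by (simp add: algebra_simps power2_eq_square)
      with t show ?thesis
        by (simp add: zero_le_mult_iff)
    qed
    then have "r - s - G \<bullet> d \<le> 0"
      by (rule nonpos_if_le_small_multiples)
    then show ?thesis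
      by (simp add: r real d_def)
  qed (use closed_proper_convex_not_MInf[OF \<theta>, of v] in auto)
  then show ?thesis
    by (simp add: subdiff_def)
qed

section \<open>Bounds and expansions of quadratic forms\<close>

lemma linear_quadratic_upper_bound:
  fixes G :: "'a::euclidean_space \<Rightarrow> 'a"
  assumes "linear G"
  shows "\<exists>K>0. \<forall>v. v \<bullet> G v \<le> K * (norm v)\<^sup>2"
proof -
  obtain K where K: "K > 0" "\<And>v. norm (G v) \<le> norm v * K"
    using bounded_linear.pos_bounded[OF linear_conv_bounded_linear[THEN iffD1, OF assms]] by blast
  have "v \<bullet> G v \<le> K * (norm v)\<^sup>2" for v
  proof -
    have "v \<bullet> G v \<le> norm v * norm (G v)"
      by (rule norm_cauchy_schwarz)
    also have "\<dots> \<le> norm v * (norm v * K)"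
      using K(2) by (intro mult_left_mono) auto
    finally show ?thesis
      by (simp add: power2_eq_square mult_ac)
  qed
  with K(1) show ?thesis
    by blast
qed

text \<open>The form attains a positive minimum on the compact unit sphere, and homogeneity extends
  the bound to all vectors.\<close>

lemma linear_quadratic_lower_bound:
  fixes G :: "'a::euclidean_space \<Rightarrow> 'a"
  assumes lin: "linear G" and pos: "\<And>v. v \<noteq> 0 \<Longrightarrow> 0 < v \<bullet> G v"
  shows "\<exists>m>0. \<forall>v. m * (norm v)\<^sup>2 \<le> v \<bullet> G v"
proof -
  let ?S = "sphere 0 1 :: 'a set"
  \<comment> \<open>A basis vector shows that the sphere is nonempty, so that the minimum is
    attained.\<close>
  obtain b :: 'a where "b \<in> Basis"
    using nonempty_Basis by blast
  then have "b \<in> ?S"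
    by simp
  then have "compact ?S" "?S \<noteq> {}"
    by auto
  moreover have "continuous_on ?S (\<lambda>v. v \<bullet> G v)"
    using lin by (intro continuous_intros linear_continuous_on) (simp add: linear_conv_bounded_linear)
  ultimately obtain v0 where v0: "v0 \<in> ?S" "\<And>v. v \<in> ?S \<Longrightarrow> v0 \<bullet> G v0 \<le> v \<bullet> G v"
    using continuous_attains_inf[of ?S "\<lambda>v. v \<bullet> G v"] by meson
  have "(v0 \<bullet> G v0) * (norm v)\<^sup>2 \<le> v \<bullet> G v" for v
  proof (cases "v = 0")
    case False
    have "v0 \<bullet> G v0 \<le> (inverse (norm v) *\<^sub>R v) \<bullet> G (inverse (norm v) *\<^sub>R v)"
      using False by (intro v0(2)) simp
    also have "\<dots> = (v \<bullet> G v) / (norm v)\<^sup>2"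
      by (simp add: linear_cmul[OF lin] power2_eq_square divide_inverse mult_ac)
    finally show ?thesis
      using False by (simp add: field_simps)
  qed (simp add: linear_0[OF lin])
  moreover have "v0 \<noteq> 0"
    using v0(1) by auto
  ultimately show ?thesis
    using pos by blast
qed

lemma self_adjointD:
  assumes "self_adjoint G"
  shows "linear G" "G v \<bullet> w = v \<bullet> G w"
  using assms adjoint_works[of G v w] by (auto simp: self_adjoint_def)

lemma inner_adjoint:
  fixes A :: "'x::euclidean_space \<Rightarrow> 'y::euclidean_space"
  assumes "linear A"
  shows "A x \<bullet> v = x \<bullet> adjoint A v"
  using adjoint_works[OF assms] by simp

lemma sqnorm_add:
  assumes "self_adjoint G"
  shows "sqnorm G (v + w) = sqnorm G v + 2 * (G v \<bullet> w) + sqnorm G w"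
  using self_adjointD[OF assms]
  by (simp add: sqnorm_def linear_add inner_add_left inner_add_right inner_commute)

lemma sqnorm_diff:
  assumes "self_adjoint G"
  shows "sqnorm G (v - w) = sqnorm G v - 2 * (G w \<bullet> v) + sqnorm G w"
proof -
  have "w \<bullet> G v = G w \<bullet> v" "v \<bullet> G w = G w \<bullet> v"
    using self_adjointD(2)[OF assms, of w v] by (simp_all add: inner_commute)
  then show ?thesis
    using self_adjointD(1)[OF assms]
    by (simp add: sqnorm_def linear_diff inner_diff_left inner_diff_right)
qed

text \<open>The smooth part of a subproblem is a quadratic, so its expansion at \<open>w\<close> is
  exact; its second-order term is at most a multiple of the squared norm, which is the bound
  required by \<open>subdiff_of_is_arg_min\<close>.\<close>

lemma subdiff_of_proximal_step:
  fixes A :: "'x::euclidean_space \<Rightarrow> 'y::euclidean_space"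
  assumes \<theta>: "closed_proper_convex \<theta>" and A: "linear A" and P: "self_adjoint P"
    and min: "is_arg_min (\<lambda>v. \<theta> v + ereal (v \<bullet> a + \<sigma>/2 * (norm (adjoint A v + b))\<^sup>2
                  + 1/2 * sqnorm P (v - v0))) (\<lambda>_. True) w"
  shows "- (a + \<sigma> *\<^sub>R A (adjoint A w + b) + P (w - v0)) \<in> subdiff \<theta> w"
proof -
  let ?h = "\<lambda>v. v \<bullet> a + \<sigma>/2 * (norm (adjoint A v + b))\<^sup>2 + 1/2 * sqnorm P (v - v0)"
  let ?G = "a + \<sigma> *\<^sub>R A (adjoint A w + b) + P (w - v0)"
  \<comment> \<open>Half the Hessian of the smooth part.\<close>
  let ?C = "\<lambda>d. (\<sigma>/2) *\<^sub>R A (adjoint A d) + (1/2) *\<^sub>R P d"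
  have linA': "linear (adjoint A)"
    using A by (rule adjoint_linear)
  have linP: "linear P"
    using P by (rule self_adjointD)
  have "linear ?C"
    by (intro linear_compose_add linear_compose_scale_right linP linear_compose[OF linA' A, unfolded o_def])
  then obtain K where K: "\<And>d. d \<bullet> ?C d \<le> K * (norm d)\<^sup>2"
    using linear_quadratic_upper_bound by blast
  have "?h (w + d) \<le> ?h w + ?G \<bullet> d + K * (norm d)\<^sup>2" for d
  proof -
    have "(norm (adjoint A (w + d) + b))\<^sup>2
        = (norm (adjoint A w + b))\<^sup>2 + 2 * (A (adjoint A w + b) \<bullet> d) + d \<bullet> A (adjoint A d)"
      unfolding inner_commute[of d "A _"] inner_adjoint[OF A] power2_norm_eq_inner
      by (simp add: linear_add[OF linA'] inner_add_left inner_add_right inner_commute)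
    moreover have "sqnorm P (w + d - v0) = sqnorm P (w - v0) + 2 * (P (w - v0) \<bullet> d) + d \<bullet> P d"
      using sqnorm_add[OF P, of "w - v0" d] by (simp add: sqnorm_def algebra_simps)
    ultimately have "?h (w + d) = ?h w + ?G \<bullet> d + d \<bullet> ?C d"
      by (simp add: inner_add_left inner_add_right inner_commute algebra_simps)
    with K[of d] show ?thesis
      by simp
  qed
  from subdiff_of_is_arg_min[where h = ?h and G = ?G, OF \<theta> min this]
  show ?thesis by simp
qed

section \<open>Monotone and closed subdifferentials, and the proximal mapping\<close>

lemma subdiff_finite:
  assumes "closed_proper_convex \<theta>" "s \<in> subdiff \<theta> v"
  obtains r where "\<theta> v = ereal r"
proof -
  obtain v1 r1 where v1: "\<theta> v1 = ereal r1"
    using assms(1) by (rule closed_proper_convex_finite_point)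
  have "\<theta> v + ereal (s \<bullet> (v1 - v)) \<le> \<theta> v1"
    using assms(2) by (simp add: subdiff_def)
  then show thesis
    using v1 closed_proper_convex_not_MInf[OF assms(1), of v] by (cases "\<theta> v") (auto intro: that)
qed

lemma subdiff_monotone:
  assumes \<theta>: "closed_proper_convex \<theta>" and s: "s \<in> subdiff \<theta> v" and t: "t \<in> subdiff \<theta> w"
  shows "0 \<le> (s - t) \<bullet> (v - w)"
proof -
  obtain a b where ab: "\<theta> v = ereal a" "\<theta> w = ereal b"
    using subdiff_finite[OF \<theta> s] subdiff_finite[OF \<theta> t] by metis
  have "\<theta> v + ereal (s \<bullet> (w - v)) \<le> \<theta> w" "\<theta> w + ereal (t \<bullet> (v - w)) \<le> \<theta> v"
    using s t by (auto simp: subdiff_def)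
  then show ?thesis
    by (simp add: ab inner_diff_left inner_diff_right algebra_simps)
qed

text \<open>For a test point of finite value \<open>r\<close>, the subgradient inequality says that
  a point depending continuously on \<open>v n\<close> and \<open>s n\<close> lies in the epigraph.
  Closedness of the epigraph then passes to the limit, with no control on the values of \<theta>
  along the sequence.\<close>

lemma subdiff_closed:
  fixes v s :: "nat \<Rightarrow> 'a::euclidean_space"
  assumes \<theta>: "closed_proper_convex \<theta>" and sub: "\<And>n. s n \<in> subdiff \<theta> (v n)"
    and lim: "v \<longlonglongrightarrow> vbar" "s \<longlonglongrightarrow> sbar"
  shows "sbar \<in> subdiff \<theta> vbar"
proof -
  have "\<theta> vbar + ereal (sbar \<bullet> (w - vbar)) \<le> \<theta> w" for w
  proof (cases "\<theta> w")
    case (real r)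
    have "(v n, r - s n \<bullet> (w - v n)) \<in> ereal_epigraph \<theta>" for n
    proof -
      obtain a where "\<theta> (v n) = ereal a"
        using subdiff_finite[OF \<theta> sub] .
      moreover have "\<theta> (v n) + ereal (s n \<bullet> (w - v n)) \<le> \<theta> w"
        using sub by (simp add: subdiff_def)
      ultimately show ?thesis
        by (simp add: ereal_epigraph_def real algebra_simps)
    qed
    moreover have "(\<lambda>n. (v n, r - s n \<bullet> (w - v n))) \<longlonglongrightarrow> (vbar, r - sbar \<bullet> (w - vbar))"
      by (intro tendsto_intros lim)
    moreover have "closed (ereal_epigraph \<theta>)"
      using \<theta> by (simp add: closed_proper_convex_def)
    ultimately have "\<theta> vbar \<le> ereal (r - sbar \<bullet> (w - vbar))"
      using closed_sequentially[of "ereal_epigraph \<theta>"] unfolding ereal_epigraph_def by fastforce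
    then show ?thesis
      using real by (cases "\<theta> vbar") auto
  qed (use closed_proper_convex_not_MInf[OF \<theta>, of w] in auto)
  then show ?thesis
    by (simp add: subdiff_def)
qed

text \<open>The subgradient supplies the affine minorant that makes the proximal objective coercive.\<close>
lemma prox_exists:
  fixes \<theta> :: "'a::euclidean_space \<Rightarrow> ereal"
  assumes \<theta>: "closed_proper_convex \<theta>" and s: "s \<in> subdiff \<theta> v0"
  shows "\<exists>w. is_arg_min (\<lambda>v'. \<theta> v' + ereal (1/2 * (norm (v' - v))\<^sup>2)) (\<lambda>_. True) w"
proof -
  obtain r0 where r0: "\<theta> v0 = ereal r0"
    using subdiff_finite[OF \<theta> s] .
  \<comment> \<open>Minimizing over the epigraph replaces lower semicontinuity of \<theta> by
    closedness of a set: \<open>F\<close> is continuous, and its sublevel set \<open>N\<close> will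
    be compact.\<close>
  define F where "F = (\<lambda>(w, r). r + 1/2 * (norm (w - v))\<^sup>2 :: real)"
  define N where "N = ereal_epigraph \<theta> \<inter> {wr. F wr \<le> F (v0, r0)}"
  have contF: "continuous_on UNIV F"
    unfolding F_def case_prod_unfold by (intro continuous_intros)
  have "closed N"
    using \<theta> contF unfolding N_def
    by (intro closed_Int closed_Collect_le continuous_intros) (auto simp: closed_proper_convex_def)
  moreover have "bounded N"
  proof -
    \<comment> \<open>Completing the square in affine minorant plus proximal term gives a quadratic
      centred at \<open>m\<close>; \<open>R\<close> bounds the squared distance to \<open>m\<close>
      on \<open>N\<close>.\<close>
    define m where "m = v - s"
    define R where "R = 2 * (F (v0, r0) - r0 + s \<bullet> v0 - s \<bullet> v + (norm s)\<^sup>2 / 2)"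
    have "norm (w - m) \<le> 1 + R \<and> \<bar>r\<bar> \<le> \<bar>F (v0, r0)\<bar> + \<bar>r0\<bar> + norm s * (1 + R + norm m + norm v0)"
      if "(w, r) \<in> N" for w r
    proof -
      have le: "\<theta> w \<le> ereal r" "r + 1/2 * (norm (w - v))\<^sup>2 \<le> F (v0, r0)"
        using that by (auto simp: N_def ereal_epigraph_def F_def)
      have "\<theta> v0 + ereal (s \<bullet> (w - v0)) \<le> \<theta> w"
        using s by (simp add: subdiff_def)
      with le(1) have lower: "r0 + s \<bullet> (w - v0) \<le> r"
        unfolding r0 plus_ereal.simps by (metis ereal_less_eq(3) order.trans)
      have "(norm (w - m))\<^sup>2 = (norm (w - v))\<^sup>2 + 2 * (s \<bullet> (w - v)) + (norm s)\<^sup>2"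
        unfolding m_def power2_norm_eq_inner
        by (simp add: inner_diff_left inner_diff_right inner_commute)
      with le(2) lower have sq: "(norm (w - m))\<^sup>2 \<le> R"
        unfolding R_def by (simp add: inner_diff_right algebra_simps)
      \<comment> \<open>The bound \<open>1 + R\<close> avoids a square root: a number above 1 is at
        most its square.\<close>
      have nm: "norm (w - m) \<le> 1 + R"
      proof (cases "norm (w - m) \<le> 1")
        case True
        then show ?thesis using sq zero_le_power2[of "norm (w - m)"] by linarith
      next
        case False
        then have "norm (w - m) \<le> (norm (w - m))\<^sup>2"
          using mult_right_mono[of 1 "norm (w - m)" "norm (w - m)"] by (simp add: power2_eq_square)
        with sq show ?thesis by linarith
      qed
      have "norm (w - v0) \<le> norm (w - m) + norm m + norm v0"
        by norm
      with nm have "norm (w - v0) \<le> 1 + R + norm m + norm v0"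
        by linarith
      then have "norm s * norm (w - v0) \<le> norm s * (1 + R + norm m + norm v0)"
        by (intro mult_left_mono) auto
      then have "\<bar>s \<bullet> (w - v0)\<bar> \<le> norm s * (1 + R + norm m + norm v0)"
        using Cauchy_Schwarz_ineq2[of s "w - v0"] by linarith
      moreover have "r \<le> F (v0, r0)"
        using le(2) zero_le_power2[of "norm (w - v)"] by linarith
      ultimately show ?thesis
        using nm lower by linarith
    qed
    then have "N \<subseteq> cball m (1 + R) \<times>
        cball 0 (\<bar>F (v0, r0)\<bar> + \<bar>r0\<bar> + norm s * (1 + R + norm m + norm v0))"
      by (force simp: dist_norm norm_minus_commute)
    moreover have "bounded (cball m (1 + R) \<times>
        cball (0::real) (\<bar>F (v0, r0)\<bar> + \<bar>r0\<bar> + norm s * (1 + R + norm m + norm v0)))"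
      by (intro bounded_Times bounded_cball)
    ultimately show ?thesis
      by (rule bounded_subset[rotated])
  qed
  ultimately have "compact N"
    by (simp add: compact_eq_bounded_closed)
  moreover have mem: "(v0, r0) \<in> N"
    by (simp add: N_def ereal_epigraph_def r0)
  ultimately obtain w r where wr: "(w, r) \<in> N" and min: "\<And>a. a \<in> N \<Longrightarrow> F (w, r) \<le> F a"
    using continuous_attains_inf[of N F] continuous_on_subset[OF contF] by (metis empty_iff prod.collapse subset_UNIV)
  have "\<theta> w + ereal (1/2 * (norm (w - v))\<^sup>2) \<le> \<theta> v' + ereal (1/2 * (norm (v' - v))\<^sup>2)" for v'
  proof (cases "\<theta> v'")
    case (real r')
    have "F (w, r) \<le> F (v', r')"
      using min[of "(v', r')"] min[OF mem] real
      by (cases "F (v', r') \<le> F (v0, r0)") (auto simp: N_def ereal_epigraph_def)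
    moreover have "\<theta> w \<le> ereal r"
      using wr by (simp add: N_def ereal_epigraph_def)
    then have "\<theta> w + ereal (1/2 * (norm (w - v))\<^sup>2) \<le> ereal (F (w, r))"
      unfolding F_def by (cases "\<theta> w") auto
    ultimately show ?thesis
      unfolding real by (simp add: F_def) (metis ereal_less_eq(3) order.trans)
  qed (use closed_proper_convex_not_MInf[OF \<theta>, of v'] in auto)
  then show ?thesis
    by (auto simp: is_arg_min_def not_less)
qed

text \<open>The given subgradient serves only to ensure existence, which turns the choice made by
  \<open>arg_min\<close> into a genuine minimizer; its optimality condition is the
  inclusion.\<close>

lemma prox_subdiff:
  fixes \<theta> :: "'a::euclidean_space \<Rightarrow> ereal"
  assumes \<theta>: "closed_proper_convex \<theta>" and s: "s \<in> subdiff \<theta> v0"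
  shows "v - prox \<theta> v \<in> subdiff \<theta> (prox \<theta> v)"
proof -
  let ?h = "\<lambda>w. 1/2 * (norm (w - v))\<^sup>2"
  let ?w = "prox \<theta> v"
  have "is_arg_min (\<lambda>v'. \<theta> v' + ereal (?h v')) (\<lambda>_. True) ?w"
    unfolding prox_def arg_min_def using prox_exists[OF \<theta> s] by (rule someI_ex)
  moreover have "?h (?w + d) \<le> ?h ?w + (?w - v) \<bullet> d + 1/2 * (norm d)\<^sup>2" for d
    unfolding power2_norm_eq_inner
    by (simp add: inner_add_left inner_add_right inner_diff_left inner_diff_right inner_commute)
  ultimately have "- (?w - v) \<in> subdiff \<theta> ?w"
    using subdiff_of_is_arg_min[OF \<theta>, of ?h] by blast
  then show ?thesis
    by simp
qed

text \<open>Monotonicity between the subgradient \<open>s\<close> at \<open>w\<close> and the one at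
  the proximal point, followed by Cauchy-Schwarz. It converts the error \<open>s + e\<close> of an
  approximate inclusion into a bound on a component of the KKT mapping.\<close>

lemma norm_diff_prox_le:
  fixes \<theta> :: "'a::euclidean_space \<Rightarrow> ereal"
  assumes \<theta>: "closed_proper_convex \<theta>" and s: "s \<in> subdiff \<theta> w"
  shows "norm (w - prox \<theta> (w - e)) \<le> norm (s + e)"
proof -
  define a where "a = prox \<theta> (w - e)"
  have "0 \<le> (s - (w - e - a)) \<bullet> (w - a)"
    using subdiff_monotone[OF \<theta> s prox_subdiff[OF \<theta> s]] by (simp add: a_def)
  then have "(norm (w - a))\<^sup>2 \<le> (s + e) \<bullet> (w - a)"
    unfolding power2_norm_eq_inner by (simp add: inner_add_left inner_diff_left)
  also have "\<dots> \<le> norm (s + e) * norm (w - a)"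
    by (rule norm_cauchy_schwarz)
  finally show ?thesis
    unfolding a_def[symmetric] by (cases "w = a") (auto simp: power2_eq_square)
qed

section \<open>Gradients of convex functions under majorization\<close>

lemma GDERIV_grad:
  fixes f :: "'a::euclidean_space \<Rightarrow> real"
  assumes "f differentiable (at y)"
  shows "GDERIV f y :> grad f y"
proof -
  obtain f' where f': "(f has_derivative f') (at y)"
    using assms by (auto simp: differentiable_def)
  then have lin: "linear f'"
    by (rule has_derivative_linear)
  \<comment> \<open>The Riesz representer of the derivative; its uniqueness below makes the definite
    description in \<open>grad\<close> meaningful.\<close>
  have "f' = (\<lambda>h. h \<bullet> adjoint f' 1)"
    using adjoint_works[OF lin] by auto
  then have D: "GDERIV f y :> adjoint f' 1"
    using f' by (metis gderiv_def)
  have "D' = adjoint f' 1" if "GDERIV f y :> D'" for D'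
  proof -
    have "(\<lambda>h. h \<bullet> D') = (\<lambda>h. h \<bullet> adjoint f' 1)"
      using that D unfolding gderiv_def by (rule has_derivative_unique)
    then show ?thesis
      by (metis vector_eq_rdot inner_commute)
  qed
  with D show ?thesis
    unfolding grad_def by (rule theI)
qed

text \<open>Restriction to the line through \<open>y\<close> and \<open>w\<close> reduces the claim
  to the tangent inequality on the reals.\<close>

lemma convex_on_grad_le:
  fixes f :: "'a::euclidean_space \<Rightarrow> real"
  assumes "convex_on UNIV f" and diff: "f differentiable_on UNIV"
  shows "f y + grad f y \<bullet> (w - y) \<le> f w"
proof -
  let ?l = "\<lambda>t. y + t *\<^sub>R (w - y)"
  have "f differentiable (at (?l 0))"
    using diff by (simp add: differentiable_on_def)
  then have "(f has_derivative (\<lambda>h. h \<bullet> grad f y)) (at (?l 0))"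
    using GDERIV_grad[of f y] by (simp add: gderiv_def)
  moreover have "(?l has_derivative (\<lambda>t. t *\<^sub>R (w - y))) (at 0)"
    by (auto intro!: derivative_eq_intros)
  ultimately have "((\<lambda>t. f (?l t)) has_derivative (\<lambda>t. (t *\<^sub>R (w - y)) \<bullet> grad f y)) (at 0)"
    by (rule has_derivative_compose[rotated])
  then have D: "((\<lambda>t. f (?l t)) has_field_derivative (grad f y \<bullet> (w - y))) (at 0)"
    unfolding has_field_derivative_def
    by (rule has_derivative_eq_rhs) (auto simp: inner_commute mult.commute)
  have "convex_on UNIV (\<lambda>t. f (?l t))"
  proof (rule convex_onI)
    fix t a b :: real
    assume "0 < t" "t < 1"
    moreover have "?l ((1 - t) *\<^sub>R a + t *\<^sub>R b) = (1 - t) *\<^sub>R ?l a + t *\<^sub>R ?l b"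
      by (simp add: algebra_simps)
    ultimately show "f (?l ((1 - t) *\<^sub>R a + t *\<^sub>R b)) \<le> (1 - t) * f (?l a) + t * f (?l b)"
      using convex_onD[OF assms(1), of t "?l a" "?l b"] by simp
  qed simp
  from convex_on_imp_above_tangent[OF this, of 0 1 "grad f y \<bullet> (w - y)"] D show ?thesis
    by simp
qed

text \<open>
  Majorization at a shifted point bounds the Bregman distance of \<open>f\<close> below by a concave quadratic
  in the shift. Adding both orders of the arguments with opposite shifts \<open>\<plusminus> (v - w) / 2\<close> gives the
  factor \<open>1/4\<close>; a single use of the descent inequality would only give \<open>1/2\<close>.
\<close>
lemma majorizes_inner_grad_diff_ge:
  fixes f :: "'a::euclidean_space \<Rightarrow> real"
  assumes f: "convex_on UNIV f" "f differentiable_on UNIV"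
    and \<Sigma>: "self_adjoint \<Sigma>" "majorizes \<Sigma> f"
  shows "- (1/4) * sqnorm \<Sigma> (w - v) \<le> (grad f v - grad f y) \<bullet> (w - y)"
proof -
  \<comment> \<open>Majorization bounds \<open>f\<close> at \<open>a - h\<close> from above and the
    tangent at \<open>b\<close> bounds it from below.\<close>
  have key: "(grad f a - grad f b) \<bullet> h - 1/2 * sqnorm \<Sigma> h
      \<le> f a - f b - grad f b \<bullet> (a - b)" for a b h
  proof -
    have "f (a - h) \<le> f a + grad f a \<bullet> (- h) + 1/2 * sqnorm \<Sigma> (- h)"
      using \<Sigma>(2)[unfolded majorizes_def, rule_format, of "a - h" a] by simp
    moreover have "f b + grad f b \<bullet> (a - h - b) \<le> f (a - h)"
      by (rule convex_on_grad_le[OF f])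
    moreover have "sqnorm \<Sigma> (- h) = sqnorm \<Sigma> h"
      using self_adjointD(1)[OF \<Sigma>(1)] by (simp add: sqnorm_def linear_neg)
    ultimately show ?thesis
      by (simp add: inner_diff_left inner_diff_right)
  qed
  let ?h = "(1/2) *\<^sub>R (v - w)"
  have "sqnorm \<Sigma> ?h = 1/4 * sqnorm \<Sigma> (w - v)" "sqnorm \<Sigma> (- ?h) = 1/4 * sqnorm \<Sigma> (w - v)"
    using self_adjointD(1)[OF \<Sigma>(1)]
    by (simp_all add: sqnorm_def linear_cmul linear_neg linear_diff inner_diff_left inner_diff_right field_simps)
  with key[of v y ?h] key[of y v "- ?h"] show ?thesis
    by (simp add: inner_diff_left inner_diff_right field_simps)
qed

section \<open>Three-point identities and the estimate for one subproblem\<close>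

lemma self_adjointI:
  fixes G :: "'a::euclidean_space \<Rightarrow> 'a"
  assumes "linear G" "\<And>v w. G v \<bullet> w = v \<bullet> G w"
  shows "self_adjoint G"
  using assms adjoint_unique[of G G] by (simp add: self_adjoint_def)

lemma linear_norm_bound:
  fixes h :: "'a::euclidean_space \<Rightarrow> 'b::euclidean_space"
  assumes "linear h"
  shows "\<exists>K>0. \<forall>v. norm (h v) \<le> K * norm v"
  using bounded_linear.pos_bounded[OF linear_conv_bounded_linear[THEN iffD1, OF assms]]
  by (metis mult.commute)

lemma tendsto_linear:
  fixes h :: "'a::euclidean_space \<Rightarrow> 'b::euclidean_space"
  assumes "linear h" "(X \<longlongrightarrow> v) F"
  shows "((\<lambda>n. h (X n)) \<longlongrightarrow> h v) F"
  using bounded_linear.tendsto[OF linear_conv_bounded_linear[THEN iffD1, OF assms(1)] assms(2)] .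

text \<open>The three-point identity; with its operator version below it turns the inner products
  from monotonicity into differences of squared distances.\<close>

lemma two_inner_diff:
  fixes a b c :: "'a::real_inner"
  shows "2 * ((a - b) \<bullet> (a - c)) = (norm (a - c))\<^sup>2 - (norm (b - c))\<^sup>2 + (norm (a - b))\<^sup>2"
  unfolding power2_norm_eq_inner
  by (simp add: inner_diff_left inner_diff_right inner_commute algebra_simps)

lemma two_inner_diff_self_adjoint:
  assumes "self_adjoint G"
  shows "2 * (G (a - b) \<bullet> (a - c)) = sqnorm G (a - c) - sqnorm G (b - c) + sqnorm G (a - b)"
proof -
  have lin: "linear G"
    using assms by (rule self_adjointD)
  have "sqnorm G (b - c) = sqnorm G ((a - c) + - (a - b))"
    by simp
  also have "\<dots> = sqnorm G (a - c) + 2 * (G (a - c) \<bullet> - (a - b)) + sqnorm G (- (a - b))"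
    by (rule sqnorm_add[OF assms])
  also have "sqnorm G (- (a - b)) = sqnorm G (a - b)"
    unfolding sqnorm_def linear_neg[OF lin] by (simp only: inner_minus_left inner_minus_right minus_minus)
  also have "G (a - c) \<bullet> - (a - b) = - (G (a - b) \<bullet> (a - c))"
    unfolding self_adjointD(2)[OF assms, of "a - c"] linear_neg[OF lin] by (simp add: inner_commute)
  finally show ?thesis
    by simp
qed

text \<open>Common to both subproblems: monotonicity is tested between the new point and a KKT
  component, the gradient difference costs a quarter of \<open>sqnorm \<Sigma> (w - v)\<close>,
  doubled here to one half, and the three-point identity handles the proximal term.\<close>

lemma proximal_step_estimate:
  fixes f :: "'a::euclidean_space \<Rightarrow> real"
  assumes \<theta>: "closed_proper_convex \<theta>"
    and f: "convex_on UNIV f" "f differentiable_on UNIV"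
    and \<Sigma>: "self_adjoint \<Sigma>" "majorizes \<Sigma> f" and P: "self_adjoint P"
    and w: "- (grad f v + a + P (w - v)) \<in> subdiff \<theta> w"
    and vbar: "- (grad f vbar + abar) \<in> subdiff \<theta> vbar"
  shows "2 * ((a - abar) \<bullet> (w - vbar)) + sqnorm P (w - vbar)
      + (sqnorm P (w - v) - 1/2 * sqnorm \<Sigma> (w - v)) \<le> sqnorm P (v - vbar)"
proof -
  have "0 \<le> (- (grad f v + a + P (w - v)) - - (grad f vbar + abar)) \<bullet> (w - vbar)"
    by (rule subdiff_monotone[OF \<theta> w vbar])
  moreover have "- (1/4) * sqnorm \<Sigma> (w - v) \<le> (grad f v - grad f vbar) \<bullet> (w - vbar)"
    by (rule majorizes_inner_grad_diff_ge[OF f \<Sigma>])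
  moreover note two_inner_diff_self_adjoint[OF P, of w v vbar]
  ultimately show ?thesis
    by (simp add: inner_diff_left inner_add_left)
qed

lemma self_adjoint_add:
  assumes "self_adjoint G" "self_adjoint H"
  shows "self_adjoint (\<lambda>v. G v + H v)"
  using self_adjointD[OF assms(1)] self_adjointD[OF assms(2)]
  by (intro self_adjointI linear_compose_add) (auto simp: inner_add_left inner_add_right)

lemma half_sqnorm_le_if_loewner_ge:
  assumes "S \<succeq>\<^sub>L (\<lambda>v. - (1/2) *\<^sub>R \<Sigma> v)"
  shows "1/2 * sqnorm \<Sigma> v \<le> sqnorm (\<lambda>h. \<Sigma> h + S h) v"
  using assms unfolding loewner_ge_def psd_def
  by (auto simp: sqnorm_def inner_add_right inner_diff_right dest!: spec[of _ v])

text \<open>The difference of squared norms is what \<open>proximal_step_estimate\<close> leaves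
  over. The strict operator condition makes it control the full increment once the term in
  \<open>adjoint A v\<close> is added.\<close>

lemma sqnorm_lower_bound_if_loewner_gt:
  fixes A :: "'x::euclidean_space \<Rightarrow> 'y::euclidean_space"
  assumes A: "linear A" and pos: "(\<lambda>v. (1/2) *\<^sub>R \<Sigma> v + S v + \<sigma> *\<^sub>R A (adjoint A v)) \<succ>\<^sub>L (\<lambda>_. 0)"
  shows "\<exists>m>0. \<forall>v. m * (norm v)\<^sup>2
      \<le> sqnorm (\<lambda>h. \<Sigma> h + S h) v - 1/2 * sqnorm \<Sigma> v + \<sigma> * (norm (adjoint A v))\<^sup>2"
proof -
  let ?G = "\<lambda>v. (1/2) *\<^sub>R \<Sigma> v + S v + \<sigma> *\<^sub>R A (adjoint A v)"
  have "linear ?G" "\<And>v. v \<noteq> 0 \<Longrightarrow> 0 < v \<bullet> ?G v"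
    using pos by (auto simp: loewner_gt_def posdef_def self_adjoint_def)
  then have "\<exists>m>0. \<forall>v. m * (norm v)\<^sup>2 \<le> v \<bullet> ?G v"
    by (rule linear_quadratic_lower_bound)
  moreover have "v \<bullet> A (adjoint A v) = (norm (adjoint A v))\<^sup>2" for v
    unfolding power2_norm_eq_inner by (metis inner_adjoint[OF A] inner_commute)
  then have "v \<bullet> ?G v = sqnorm (\<lambda>h. \<Sigma> h + S h) v - 1/2 * sqnorm \<Sigma> v + \<sigma> * (norm (adjoint A v))\<^sup>2" for v
    by (simp add: sqnorm_def inner_add_right)
  ultimately show ?thesis
    by simp
qed

section \<open>Optimality of KKT points and the weighted distance\<close>

lemma linear_Estar:
  fixes A :: "'x::euclidean_space \<Rightarrow> 'y::euclidean_space" and B :: "'x \<Rightarrow> 'z::euclidean_space"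
  assumes "linear A" "linear B"
  shows "linear (Estar A B)"
  using adjoint_linear[OF assms(1)] adjoint_linear[OF assms(2)]
  by (intro linearI) (auto simp: Estar_def linear_add linear_cmul algebra_simps)

lemma linear_Mop:
  fixes A :: "'x::euclidean_space \<Rightarrow> 'y::euclidean_space" and B :: "'x \<Rightarrow> 'z::euclidean_space"
  assumes A: "linear A" and B: "linear B"
    and "linear \<Sigma>f" "linear \<Sigma>g" "linear S" "linear T"
  shows "linear (Mop A B \<Sigma>f \<Sigma>g S T \<sigma> \<tau>)"
proof -
  have E: "linear (Emap A B)" "linear (Estar A B)"
    using linear_Estar[OF A B] adjoint_linear by (auto simp: Emap_def)
  have "Estar A B (y1 + y2, z1 + z2, x1 + x2) = Estar A B (y1, z1, x1) + Estar A B (y2, z2, x2)"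
    "Estar A B (r *\<^sub>R y1, r *\<^sub>R z1, r *\<^sub>R x1) = r *\<^sub>R Estar A B (y1, z1, x1)"
    for y1 y2 z1 z2 x1 x2 r
    using linear_add[OF E(2), of "(y1, z1, x1)" "(y2, z2, x2)"]
      linear_cmul[OF E(2), of r "(y1, z1, x1)"] by simp_all
  then show ?thesis
    using assms adjoint_linear[OF B] E(1)
    by (intro linearI) (auto simp: Mop_def linear_add linear_cmul scaleR_add_right algebra_simps)
qed

lemma sqnorm_Mop:
  fixes A :: "'x::euclidean_space \<Rightarrow> 'y::euclidean_space" and B :: "'x \<Rightarrow> 'z::euclidean_space"
  assumes A: "linear A" and B: "linear B"
  shows "sqnorm (Mop A B \<Sigma>f \<Sigma>g S T \<sigma> \<tau>) (y, z, x)
    = sqnorm (\<lambda>h. \<Sigma>f h + S h) y + sqnorm (\<lambda>h. \<Sigma>g h + T h) z + \<sigma> * (norm (adjoint B z))\<^sup>2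
      + inverse (\<tau> * \<sigma>) * (norm x)\<^sup>2 + s_tau \<tau> * \<sigma> * (norm (adjoint A y + adjoint B z))\<^sup>2"
proof -
  have "(y, z, x) \<bullet> Emap A B w = Estar A B (y, z, x) \<bullet> w" for w
    unfolding Emap_def by (rule adjoint_works[OF linear_Estar[OF A B]])
  moreover have "z \<bullet> B (adjoint B z) = adjoint B z \<bullet> adjoint B z"
    by (metis inner_adjoint[OF B] inner_commute)
  ultimately show ?thesis
    unfolding sqnorm_def Mop_def power2_norm_eq_inner
    by (simp add: inner_add_right Estar_def del: inner_Pair)
       (simp add: inner_add_right)
qed

text \<open>The upper limit on \<tau> is the positive root of the quadratic \<tau>*\<tau> - \<tau> -
  1, so it means \<tau>*\<tau> < 1 + \<tau>. The remaining work is to exhibit the slack of each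
  bound, depending on which argument attains the minimum in \<open>s_tau\<close>.\<close>

lemma s_tau_bounds:
  assumes "0 < \<tau>" "\<tau> < (1 + sqrt 5) / 2"
  shows "(1 - \<tau>)\<^sup>2 < s_tau \<tau>" "s_tau \<tau> < 2 - \<tau>"
proof -
  have "0 < (sqrt 5 - 1) / (2 :: real)"
    by simp
  then have "0 < \<tau> + (sqrt 5 - 1) / 2"
    using assms(1) by (rule add_pos_pos[rotated])
  then have "(\<tau> - (1 + sqrt 5) / 2) * (\<tau> + (sqrt 5 - 1) / 2) < 0"
    using assms(2) by (intro mult_neg_pos) simp_all
  also have "(\<tau> - (1 + sqrt 5) / 2) * (\<tau> + (sqrt 5 - 1) / 2) = \<tau> * \<tau> - \<tau> - (sqrt 5 * sqrt 5 - 1) / 4"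
    by (simp add: field_simps)
  finally have golden: "\<tau> * \<tau> < 1 + \<tau>"
    by simp
  show "(1 - \<tau>)\<^sup>2 < s_tau \<tau>"
  proof (cases "\<tau> \<le> 1")
    case True
    then have "min \<tau> (inverse \<tau>) = \<tau>"
      using assms by (simp add: min_def one_le_inverse_iff) (smt (verit) one_le_inverse)
    then have "s_tau \<tau> - (1 - \<tau>)\<^sup>2 = 1/4 + \<tau> - \<tau> * \<tau>"
      by (simp add: s_tau_def power2_eq_square field_simps)
    moreover have "\<tau> * \<tau> \<le> \<tau>"
      using True assms by (simp add: mult_left_le)
    ultimately show ?thesis
      by linarith
  next
    case False
    then have "min \<tau> (inverse \<tau>) = inverse \<tau>"
      using inverse_le_1_iff[of \<tau>] by (simp add: min_def)
    \<comment> \<open>This is four times the slack, and the golden-ratio quadratic is a factor of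
      it.\<close>
    moreover have "0 < (4 * \<tau> - 3) * (1 + \<tau> - \<tau> * \<tau>) / \<tau>"
      using False golden by (intro divide_pos_pos mult_pos_pos) auto
    moreover have "(4 * \<tau> - 3) * (1 + \<tau> - \<tau> * \<tau>) / \<tau> = 1 + 7 * \<tau> - 3 * inverse \<tau> - 4 * \<tau> * \<tau>"
      using assms by (simp add: field_simps)
    ultimately show ?thesis
      by (simp add: s_tau_def power2_eq_square algebra_simps)
  qed
  show "s_tau \<tau> < 2 - \<tau>"
  proof -
    \<comment> \<open>The slack is 3/4 times 1 - \<tau> + min \<tau> (1/\<tau>): this is 3/4 if the
      minimum is \<tau>, and 3/4 of the present expression otherwise.\<close>
    have "0 < (1 + \<tau> - \<tau> * \<tau>) / \<tau>"
      using assms golden by (intro divide_pos_pos) auto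
    also have "\<dots> = 1 - \<tau> + inverse \<tau>"
      using assms by (simp add: field_simps)
    finally show ?thesis
      by (auto simp: s_tau_def min_def)
  qed
qed

text \<open>The form is positive definite when \<open>t\<^sup>2 < s\<close>. Splitting
  \<open>s\<close> at some \<open>m\<close> strictly between these numbers completes a square and
  leaves positive multiples of both squared norms. It is used with \<open>t = 1 - \<tau>\<close> and
  \<open>s = s_tau \<tau>\<close>.\<close>

lemma cross_term_lower_bound:
  fixes s t :: real
  assumes "t\<^sup>2 < s"
  shows "\<exists>\<delta>>0. \<forall>a b :: 'a::real_inner. \<delta> * ((norm a)\<^sup>2 + (norm b)\<^sup>2) \<le> (norm b)\<^sup>2 + s * (norm a)\<^sup>2 - 2 * t * (b \<bullet> a)"
proof -
  define m where "m = (t\<^sup>2 + s) / 2"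
  have m: "t\<^sup>2 < m" "m < s" "0 < m"
    using assms by (auto simp: m_def) (smt (verit) zero_le_power2)
  define \<delta> where "\<delta> = min (1 - t\<^sup>2 / m) (s - m)"
  have "\<delta> > 0"
    using m by (simp add: \<delta>_def)
  moreover have "\<delta> * ((norm a)\<^sup>2 + (norm b)\<^sup>2) \<le> (norm b)\<^sup>2 + s * (norm a)\<^sup>2 - 2 * t * (b \<bullet> a)"
    for a b :: 'a
  proof -
    have "0 \<le> (norm (t *\<^sub>R b - m *\<^sub>R a))\<^sup>2 / m"
      using m by simp
    also have "\<dots> = t\<^sup>2 / m * (norm b)\<^sup>2 + m * (norm a)\<^sup>2 - 2 * t * (b \<bullet> a)"
      unfolding power2_norm_eq_inner using m
      by (simp add: inner_diff_left inner_diff_right inner_commute field_simps power2_eq_square)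
    finally have "(1 - t\<^sup>2 / m) * (norm b)\<^sup>2 + (s - m) * (norm a)\<^sup>2
        \<le> (norm b)\<^sup>2 + s * (norm a)\<^sup>2 - 2 * t * (b \<bullet> a)"
      by (simp add: algebra_simps)
    moreover have "\<delta> * (norm b)\<^sup>2 \<le> (1 - t\<^sup>2 / m) * (norm b)\<^sup>2" "\<delta> * (norm a)\<^sup>2 \<le> (s - m) * (norm a)\<^sup>2"
      by (auto simp: \<delta>_def intro!: mult_right_mono)
    ultimately show ?thesis
      by (simp add: algebra_simps)
  qed
  ultimately show ?thesis
    by blast
qed

section \<open>Primal and dual optimality of KKT points\<close>

lemma zero_in_translate_iff:
  fixes a b :: "'a::ab_group_add"
  shows "0 \<in> (\<lambda>v. v + a + b) ` C \<longleftrightarrow> - (a + b) \<in> C"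
  by (auto simp: image_iff add.assoc eq_neg_iff_add_eq_0[symmetric])

lemma KKT_points_iff:
  "(y, z, x) \<in> KKT_points p f q g A B c \<longleftrightarrow>
    - (grad f y + A x) \<in> subdiff p y \<and> - (grad g z + B x) \<in> subdiff q z \<and>
    adjoint A y + adjoint B z = c"
  unfolding KKT_points_def by (simp only: zero_in_translate_iff mem_Collect_eq prod.case)

text \<open>The saddle-point inequality of the Lagrangian: the subgradient inequalities of
  \<open>p\<close> and \<open>q\<close> and the tangent inequalities of \<open>f\<close> and
  \<open>g\<close> add up, the gradients cancel, and the adjoints collect the multiplier
  terms.\<close>

lemma KKT_point_objective_le:
  fixes A :: "'x::euclidean_space \<Rightarrow> 'y::euclidean_space" and B :: "'x \<Rightarrow> 'z::euclidean_space"
  assumes p: "closed_proper_convex p" and q: "closed_proper_convex q"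
    and f: "convex_on UNIV f" "f differentiable_on UNIV"
    and g: "convex_on UNIV g" "g differentiable_on UNIV"
    and A: "linear A" and B: "linear B"
    and KKT: "(ybar, zbar, xbar) \<in> KKT_points p f q g A B c"
  shows "objective p f q g (ybar, zbar)
    \<le> objective p f q g (y, z) + ereal (xbar \<bullet> (adjoint A y + adjoint B z - c))"
proof -
  have sub: "- (grad f ybar + A xbar) \<in> subdiff p ybar" "- (grad g zbar + B xbar) \<in> subdiff q zbar"
    and c: "adjoint A ybar + adjoint B zbar = c"
    using KKT by (auto simp: KKT_points_iff)
  obtain a b where ab: "p ybar = ereal a" "q zbar = ereal b"
    using subdiff_finite[OF p sub(1)] subdiff_finite[OF q sub(2)] by metis
  have le: "p ybar + ereal (- (grad f ybar + A xbar) \<bullet> (y - ybar)) \<le> p y"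
    "q zbar + ereal (- (grad g zbar + B xbar) \<bullet> (z - zbar)) \<le> q z"
    using sub by (auto simp: subdiff_def)
  show ?thesis
  proof (cases "p y = \<infinity> \<or> q z = \<infinity>")
    case True
    then show ?thesis
      using closed_proper_convex_not_MInf[OF p, of y] closed_proper_convex_not_MInf[OF q, of z]
      by (auto simp: objective_def)
  next
    case False
    then obtain a' b' where ab': "p y = ereal a'" "q z = ereal b'"
      using closed_proper_convex_not_MInf[OF p, of y] closed_proper_convex_not_MInf[OF q, of z]
      by (cases "p y"; cases "q z") auto
    have "A xbar \<bullet> (y - ybar) = xbar \<bullet> adjoint A y - xbar \<bullet> adjoint A ybar"
      "B xbar \<bullet> (z - zbar) = xbar \<bullet> adjoint B z - xbar \<bullet> adjoint B zbar"
      using A B by (simp_all add: inner_diff_right inner_adjoint)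
    moreover have "xbar \<bullet> (adjoint A y + adjoint B z - c) = xbar \<bullet> adjoint A y
        - xbar \<bullet> adjoint A ybar + (xbar \<bullet> adjoint B z - xbar \<bullet> adjoint B zbar)"
      by (simp add: c[symmetric] inner_diff_right inner_add_right)
    moreover have "f ybar + grad f ybar \<bullet> (y - ybar) \<le> f y" "g zbar + grad g zbar \<bullet> (z - zbar) \<le> g z"
      using convex_on_grad_le f g by blast+
    ultimately show ?thesis
      using le unfolding ab ab'
      by (simp add: objective_def ab ab' inner_add_left inner_diff_left)
  qed
qed

text \<open>On feasible points the multiplier term vanishes, which gives primal optimality. Every
  dual value is at most the objective at the feasible pair \<open>(ybar, zbar)\<close>, and
  \<open>xbar\<close> reaches that value.\<close>

lemma KKT_point_optimal:
  fixes A :: "'x::euclidean_space \<Rightarrow> 'y::euclidean_space" and B :: "'x \<Rightarrow> 'z::euclidean_space"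
  assumes p: "closed_proper_convex p" and q: "closed_proper_convex q"
    and f: "convex_on UNIV f" "f differentiable_on UNIV"
    and g: "convex_on UNIV g" "g differentiable_on UNIV"
    and A: "linear A" and B: "linear B"
    and KKT: "(ybar, zbar, xbar) \<in> KKT_points p f q g A B c"
  shows "primal_optimal p f q g A B c (ybar, zbar)" "dual_optimal p f q g A B c xbar"
proof -
  note le = KKT_point_objective_le[OF assms]
  have c: "adjoint A ybar + adjoint B zbar = c"
    using KKT by (auto simp: KKT_points_iff)
  show "primal_optimal p f q g A B c (ybar, zbar)"
    unfolding primal_optimal_def is_arg_min_def
  proof (intro conjI notI)
    show "feasible A B c (ybar, zbar)"
      by (simp add: feasible_def c)
  next
    assume "\<exists>v. feasible A B c v \<and> objective p f q g v < objective p f q g (ybar, zbar)"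
    then obtain y z where "adjoint A y + adjoint B z = c"
        "objective p f q g (y, z) < objective p f q g (ybar, zbar)"
      by (auto simp: feasible_def)
    with le[of y z] show False
      by (simp add: zero_ereal_def[symmetric])
  qed
  have "dual_objective p f q g A B c x \<le> dual_objective p f q g A B c xbar" for x
  proof -
    have "dual_objective p f q g A B c x
        \<le> objective p f q g (ybar, zbar) + ereal (x \<bullet> (adjoint A ybar + adjoint B zbar - c))"
      unfolding dual_objective_def by (rule INF_lower2[of "(ybar, zbar)"]) auto
    also have "\<dots> = objective p f q g (ybar, zbar)"
      by (simp add: c zero_ereal_def[symmetric])
    also have "\<dots> \<le> dual_objective p f q g A B c xbar"
      unfolding dual_objective_def by (rule INF_greatest) (use le in auto)
    finally show ?thesis .
  qed
  then show "dual_optimal p f q g A B c xbar"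
    by (simp add: dual_optimal_def is_arg_max_def not_less)
qed

section \<open>Squared distance to a set in the operator norm\<close>

lemma op_dist_sq_le:
  fixes G :: "'a::euclidean_space \<Rightarrow> 'a"
  assumes G: "\<And>v. 0 \<le> sqnorm G v" and v: "v \<in> K"
  shows "(op_dist G u K)\<^sup>2 \<le> sqnorm G (u - v)"
proof -
  have "op_dist G u K \<le> sqrt (sqnorm G (u - v))"
    unfolding op_dist_def by (rule cINF_lower[OF _ v]) (use G in \<open>auto intro!: bdd_belowI[of _ 0]\<close>)
  moreover have "0 \<le> op_dist G u K"
    unfolding op_dist_def using v G by (intro cINF_greatest) auto
  ultimately have "(op_dist G u K)\<^sup>2 \<le> (sqrt (sqnorm G (u - v)))\<^sup>2"
    by (rule power_mono)
  with G show ?thesis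
    by simp
qed

lemma le_op_dist_sq:
  fixes G :: "'a::euclidean_space \<Rightarrow> 'a"
  assumes "K \<noteq> {}" "\<And>v. v \<in> K \<Longrightarrow> b \<le> sqnorm G (u - v)"
  shows "b \<le> (op_dist G u K)\<^sup>2"
proof (cases "0 \<le> b")
  case True
  have "sqrt b \<le> op_dist G u K"
    unfolding op_dist_def using assms by (intro cINF_greatest) auto
  then have "(sqrt b)\<^sup>2 \<le> (op_dist G u K)\<^sup>2"
    using True by (intro power_mono) auto
  with True show ?thesis
    by simp
next
  case False
  then show ?thesis
    using zero_le_power2[of "op_dist G u K"] by linarith
qed

text \<open>Subregularity speaks of the Euclidean distance and the rate of the operator distance;
  this passes from one to the other.\<close>

lemma op_dist_sq_le_infdist:
  fixes G :: "'a::euclidean_space \<Rightarrow> 'a"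
  assumes G: "\<And>v. 0 \<le> sqnorm G v" and C: "0 < C" "\<And>v. sqnorm G v \<le> C * (norm v)\<^sup>2"
    and K: "K \<noteq> {}"
  shows "(op_dist G u K)\<^sup>2 \<le> C * (infdist u K)\<^sup>2"
proof -
  have "sqrt ((op_dist G u K)\<^sup>2 / C) \<le> dist u v" if "v \<in> K" for v
  proof -
    have "(op_dist G u K)\<^sup>2 \<le> C * (norm (u - v))\<^sup>2"
      using op_dist_sq_le[where K = K, OF G that, of u] C(2)[of "u - v"] by linarith
    then show ?thesis
      using C(1) by (intro real_le_lsqrt) (auto simp: field_simps dist_norm)
  qed
  then have "sqrt ((op_dist G u K)\<^sup>2 / C) \<le> infdist u K"
    unfolding infdist_notempty[OF K] using K by (intro cINF_greatest) auto
  then have "(op_dist G u K)\<^sup>2 / C \<le> (infdist u K)\<^sup>2"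
    by (rule sqrt_le_D)
  with C(1) show ?thesis
    by (simp add: field_simps)
qed

text \<open>Only finitely many indices precede \<open>k0\<close>, and each has a ratio below 1, so
  the maximum of these ratios and \<mu> works everywhere.\<close>

lemma uniform_contraction_factor:
  fixes a :: "nat \<Rightarrow> real"
  assumes nonneg: "\<And>k. 0 \<le> a k"
    and step: "\<And>k. 1 \<le> k \<Longrightarrow> a (k + 1) = 0 \<or> a (k + 1) < a k"
    and tail: "\<And>k. k0 \<le> k \<Longrightarrow> a (k + 1) \<le> \<mu> * a k" and \<mu>: "\<mu> < 1"
  shows "\<exists>\<nu>. \<mu> \<le> \<nu> \<and> \<nu> < 1 \<and> (\<forall>k\<ge>1. a (k + 1) \<le> \<nu> * a k)"
proof -
  define R where "R = insert \<mu> ((\<lambda>k. a (k + 1) / a k) ` {1..k0})"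
  have fin: "finite R"
    by (simp add: R_def)
  \<comment> \<open>Division by zero yields 0, so the bound also holds when
    \<open>a k = 0\<close>.\<close>
  have ratio: "a (k + 1) / a k < 1" if "1 \<le> k" for k
    using step[OF that] nonneg[of k] nonneg[of "k + 1"] by (auto simp: divide_simps)
  have "\<mu> \<le> Max R" "Max R < 1"
    using fin \<mu> ratio by (auto simp: R_def)
  moreover have "a (k + 1) \<le> Max R * a k" if k: "1 \<le> k" for k
  proof (cases "k \<le> k0")
    case True
    then have "a (k + 1) / a k \<le> Max R"
      using fin k by (intro Max_ge) (auto simp: R_def)
    then have *: "a (k + 1) / a k * a k \<le> Max R * a k"
      using nonneg by (intro mult_right_mono)
    show ?thesis
    proof (cases "a k = 0")
      case True
      then have "a (k + 1) = 0"
        using step[OF k] nonneg[of "k + 1"] by auto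
      with True show ?thesis by simp
    qed (use * in simp)
  next
    case False
    then have "a (k + 1) \<le> \<mu> * a k"
      by (intro tail) auto
    also have "\<dots> \<le> Max R * a k"
      using \<open>\<mu> \<le> Max R\<close> nonneg by (intro mult_right_mono)
    finally show ?thesis .
  qed
  ultimately show ?thesis
    by blast
qed

section \<open>Descent along the iterates\<close>

locale majorized_ipadmm =
  fixes p :: "'y::euclidean_space \<Rightarrow> ereal" and f :: "'y \<Rightarrow> real"
    and q :: "'z::euclidean_space \<Rightarrow> ereal" and g :: "'z \<Rightarrow> real"
    and A :: "'x::euclidean_space \<Rightarrow> 'y" and B :: "'x \<Rightarrow> 'z" and c :: 'x
    and \<Sigma>f S :: "'y \<Rightarrow> 'y" and \<Sigma>g T :: "'z \<Rightarrow> 'z"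
    and \<sigma> \<tau> :: real
    and y :: "nat \<Rightarrow> 'y" and z :: "nat \<Rightarrow> 'z" and x :: "nat \<Rightarrow> 'x"
  assumes f: "convex_on UNIV f" "f differentiable_on UNIV" "\<exists>L. L-lipschitz_on UNIV (grad f)"
    and g: "convex_on UNIV g" "g differentiable_on UNIV" "\<exists>L. L-lipschitz_on UNIV (grad g)"
    and p: "closed_proper_convex p" and q: "closed_proper_convex q"
    and A: "linear A" and B: "linear B"
    and \<Sigma>f: "psd \<Sigma>f" "majorizes \<Sigma>f f"
    and \<Sigma>g: "psd \<Sigma>g" "majorizes \<Sigma>g g"
    and KKT_nonempty: "KKT_points p f q g A B c \<noteq> {}"
    and \<tau>: "0 < \<tau>" "\<tau> < (1 + sqrt 5) / 2" and \<sigma>: "0 < \<sigma>"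
    and S: "self_adjoint S" "S \<succeq>\<^sub>L (\<lambda>v. - (1/2) *\<^sub>R \<Sigma>f v)"
           "(\<lambda>v. (1/2) *\<^sub>R \<Sigma>f v + S v + \<sigma> *\<^sub>R A (adjoint A v)) \<succ>\<^sub>L (\<lambda>_. 0)"
    and T: "self_adjoint T" "T \<succeq>\<^sub>L (\<lambda>w. - (1/2) *\<^sub>R \<Sigma>g w)"
           "(\<lambda>w. (1/2) *\<^sub>R \<Sigma>g w + T w + \<sigma> *\<^sub>R B (adjoint B w)) \<succ>\<^sub>L (\<lambda>_. 0)"
    and seq: "majorized_iPADMM p f q g A B c \<Sigma>f \<Sigma>g S T \<sigma> \<tau> y z x"
begin

abbreviation "A' \<equiv> adjoint A"
abbreviation "B' \<equiv> adjoint B"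
abbreviation "P \<equiv> \<lambda>h. \<Sigma>f h + S h"
abbreviation "Q \<equiv> \<lambda>h. \<Sigma>g h + T h"
abbreviation "M \<equiv> Mop A B \<Sigma>f \<Sigma>g S T \<sigma> \<tau>"
abbreviation "\<Omega> \<equiv> KKT_points p f q g A B c"
abbreviation "dy k \<equiv> y (Suc k) - y k"
abbreviation "dz k \<equiv> z (Suc k) - z k"
abbreviation "u k \<equiv> (y k, z k, x k)"

definition r :: "nat \<Rightarrow> 'x" where
  "r k = A' (y k) + B' (z k) - c"

text \<open>The new residual stands for the multiplier increment, which is
  \<open>\<tau> * \<sigma>\<close> times it by \<open>x_Suc\<close>.\<close>

definition step :: "nat \<Rightarrow> 'y \<times> 'z \<times> 'x" where
  "step k = (dy k, dz k, r (Suc k))"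

lemma A'_linear: "linear A'" and B'_linear: "linear B'"
  using A B by (auto intro: adjoint_linear)

lemma \<Sigma>f_self_adjoint: "self_adjoint \<Sigma>f" and \<Sigma>g_self_adjoint: "self_adjoint \<Sigma>g"
  using \<Sigma>f \<Sigma>g by (auto simp: psd_def)

lemma P_self_adjoint: "self_adjoint P" and Q_self_adjoint: "self_adjoint Q"
  using \<Sigma>f_self_adjoint \<Sigma>g_self_adjoint S(1) T(1) by (auto intro: self_adjoint_add)

lemma P_linear: "linear P" and Q_linear: "linear Q"
  using P_self_adjoint Q_self_adjoint by (auto intro: self_adjointD)

lemma half_\<Sigma>f_le: "1/2 * sqnorm \<Sigma>f v \<le> sqnorm P v"
  and half_\<Sigma>g_le: "1/2 * sqnorm \<Sigma>g w \<le> sqnorm Q w"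
  using half_sqnorm_le_if_loewner_ge S(2) T(2) by blast+

lemma sqnorm_P_nonneg: "0 \<le> sqnorm P v" and sqnorm_Q_nonneg: "0 \<le> sqnorm Q w"
proof -
  have "0 \<le> sqnorm \<Sigma>f v" "0 \<le> sqnorm \<Sigma>g w"
    using \<Sigma>f \<Sigma>g by (auto simp: psd_def sqnorm_def)
  then show "0 \<le> sqnorm P v" "0 \<le> sqnorm Q w"
    using half_\<Sigma>f_le[of v] half_\<Sigma>g_le[of w] by linarith+
qed

lemma s_tau_pos: "0 < s_tau \<tau>"
  using s_tau_bounds(1)[OF \<tau>] zero_le_power2[of "1 - \<tau>"] by linarith

lemma x_Suc: "x (Suc k) = x k + (\<tau> * \<sigma>) *\<^sub>R r (Suc k)"
  using seq by (simp add: majorized_iPADMM_def r_def)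

text \<open>The \<open>y\<close>-subproblem still sees \<open>z k\<close>, so the new residual
  appears corrected by \<open>B' (dz k)\<close>.\<close>

lemma y_step:
  "- (grad f (y k) + (A (x k) + \<sigma> *\<^sub>R A (r (Suc k) - B' (dz k))) + P (dy k)) \<in> subdiff p (y (Suc k))"
proof -
  have "is_arg_min
          (\<lambda>v. p v + ereal (v \<bullet> (grad f (y k) + A (x k))
                 + \<sigma>/2 * (norm (A' v + B' (z k) - c))\<^sup>2
                 + 1/2 * sqnorm P (v - y k)))
          (\<lambda>_. True) (y (Suc k))"
    using seq unfolding majorized_iPADMM_def by blast
  moreover have "A' v + B' (z k) - c = A' v + (B' (z k) - c)" for v
    by simp
  ultimately have "- (grad f (y k) + A (x k) + \<sigma> *\<^sub>R A (A' (y (Suc k)) + (B' (z k) - c)) + P (dy k))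
      \<in> subdiff p (y (Suc k))"
    by (intro subdiff_of_proximal_step[OF p A P_self_adjoint]) (simp only:)
  moreover have "A' (y (Suc k)) + (B' (z k) - c) = r (Suc k) - B' (dz k)"
    by (simp add: r_def linear_diff[OF B'_linear])
  ultimately show ?thesis
    by (simp only: add.assoc)
qed

lemma z_step:
  "- (grad g (z k) + (B (x k) + \<sigma> *\<^sub>R B (r (Suc k))) + Q (dz k)) \<in> subdiff q (z (Suc k))"
proof -
  have "is_arg_min
          (\<lambda>w. q w + ereal (w \<bullet> (grad g (z k) + B (x k))
                 + \<sigma>/2 * (norm (A' (y (Suc k)) + B' w - c))\<^sup>2
                 + 1/2 * sqnorm Q (w - z k)))
          (\<lambda>_. True) (z (Suc k))"
    using seq unfolding majorized_iPADMM_def by blast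
  moreover have "A' (y (Suc k)) + B' w - c = B' w + (A' (y (Suc k)) - c)" for w
    by simp
  ultimately have "- (grad g (z k) + B (x k) + \<sigma> *\<^sub>R B (B' (z (Suc k)) + (A' (y (Suc k)) - c)) + Q (dz k))
      \<in> subdiff q (z (Suc k))"
    by (intro subdiff_of_proximal_step[OF q B Q_self_adjoint]) (simp only:)
  moreover have "B' (z (Suc k)) + (A' (y (Suc k)) - c) = r (Suc k)"
    by (simp add: r_def)
  ultimately show ?thesis
    by (simp only: add.assoc)
qed

text \<open>The sum of the two proximal step estimates. The multiplier update removes the product of
  multiplier error and residual, so the product of \<open>B' (dz k)\<close> and the new residual is
  the only term of unknown sign.\<close>

lemma one_step_estimate:
  assumes KKT: "(ybar, zbar, xbar) \<in> \<Omega>"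
  defines "E \<equiv> \<lambda>k. sqnorm P (y k - ybar) + sqnorm Q (z k - zbar) + \<sigma> * (norm (B' (z k - zbar)))\<^sup>2
      + inverse (\<tau> * \<sigma>) * (norm (x k - xbar))\<^sup>2"
  shows "E (Suc k) + (sqnorm P (dy k) - 1/2 * sqnorm \<Sigma>f (dy k)) + (sqnorm Q (dz k) - 1/2 * sqnorm \<Sigma>g (dz k))
      + \<sigma> * (norm (B' (dz k)))\<^sup>2 + (2 - \<tau>) * \<sigma> * (norm (r (Suc k)))\<^sup>2
      - 2 * \<sigma> * (B' (dz k) \<bullet> r (Suc k)) \<le> E k"
proof -
  define b where "b = B' (dz k)"
  define e where "e = B' (z (Suc k) - zbar)"
  define \<rho> where "\<rho> = r (Suc k)"
  define \<xi> where "\<xi> = x k - xbar"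
  have sub: "- (grad f ybar + A xbar) \<in> subdiff p ybar" "- (grad g zbar + B xbar) \<in> subdiff q zbar"
    and c: "A' ybar + B' zbar = c"
    using KKT by (auto simp: KKT_points_iff)
  \<comment> \<open>Feasibility of the KKT point expresses the \<open>y\<close>-error through the
    residual and the \<open>z\<close>-error.\<close>
  have Ay: "A' (y (Suc k) - ybar) = \<rho> - e"
    unfolding e_def \<rho>_def r_def unfolding c[symmetric]
    by (simp add: linear_diff[OF A'_linear] linear_diff[OF B'_linear])
  have "(A (x k) + \<sigma> *\<^sub>R A (\<rho> - b) - A xbar) \<bullet> v = (\<xi> + \<sigma> *\<^sub>R (\<rho> - b)) \<bullet> A' v" for v
    unfolding inner_adjoint[OF A, symmetric] \<xi>_def
    by (simp add: linear_add[OF A] linear_diff[OF A] linear_cmul[OF A] inner_diff_left inner_add_left)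
  with proximal_step_estimate[OF p f(1,2) \<Sigma>f_self_adjoint \<Sigma>f(2) P_self_adjoint y_step sub(1), of k]
  have Y: "2 * ((\<xi> + \<sigma> *\<^sub>R (\<rho> - b)) \<bullet> (\<rho> - e)) + sqnorm P (y (Suc k) - ybar)
      + (sqnorm P (dy k) - 1/2 * sqnorm \<Sigma>f (dy k)) \<le> sqnorm P (y k - ybar)"
    unfolding b_def[symmetric] \<rho>_def[symmetric] by (simp only: Ay)
  have "(B (x k) + \<sigma> *\<^sub>R B \<rho> - B xbar) \<bullet> w = (\<xi> + \<sigma> *\<^sub>R \<rho>) \<bullet> B' w" for w
    unfolding inner_adjoint[OF B, symmetric] \<xi>_def
    by (simp add: linear_add[OF B] linear_diff[OF B] linear_cmul[OF B] inner_diff_left inner_add_left)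
  with proximal_step_estimate[OF q g(1,2) \<Sigma>g_self_adjoint \<Sigma>g(2) Q_self_adjoint z_step sub(2), of k]
  have Z: "2 * ((\<xi> + \<sigma> *\<^sub>R \<rho>) \<bullet> e) + sqnorm Q (z (Suc k) - zbar)
      + (sqnorm Q (dz k) - 1/2 * sqnorm \<Sigma>g (dz k)) \<le> sqnorm Q (z k - zbar)"
    unfolding \<rho>_def[symmetric] e_def by (simp only:)
  have "2 * (b \<bullet> e) = (norm e)\<^sup>2 - (norm (B' (z k - zbar)))\<^sup>2 + (norm b)\<^sup>2"
    unfolding b_def e_def linear_diff[OF B'_linear] by (rule two_inner_diff)
  then have be: "\<sigma> * (2 * (b \<bullet> e)) = \<sigma> * (norm e)\<^sup>2 - \<sigma> * (norm (B' (z k - zbar)))\<^sup>2 + \<sigma> * (norm b)\<^sup>2"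
    by (simp only: distrib_left right_diff_distrib)
  have "x (Suc k) - xbar = \<xi> + (\<tau> * \<sigma>) *\<^sub>R \<rho>"
    by (simp add: x_Suc \<xi>_def \<rho>_def)
  then have "(norm (x (Suc k) - xbar))\<^sup>2 = (norm \<xi>)\<^sup>2 + (\<tau> * \<sigma>) * (2 * (\<xi> \<bullet> \<rho>) + (\<tau> * \<sigma>) * (norm \<rho>)\<^sup>2)"
    unfolding power2_norm_eq_inner by (simp add: inner_add_left inner_add_right inner_commute algebra_simps)
  \<comment> \<open>The weight of the multiplier error is chosen so that its mixed term is exactly
    the one in the sum of \<open>Y\<close> and \<open>Z\<close>.\<close>
  then have x: "inverse (\<tau> * \<sigma>) * (norm (x (Suc k) - xbar))\<^sup>2
      = inverse (\<tau> * \<sigma>) * (norm \<xi>)\<^sup>2 + 2 * (\<xi> \<bullet> \<rho>) + \<tau> * \<sigma> * (norm \<rho>)\<^sup>2"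
    using \<tau> \<sigma> by (simp only: distrib_left) (simp add: field_simps)
  have "2 * ((\<xi> + \<sigma> *\<^sub>R (\<rho> - b)) \<bullet> (\<rho> - e)) + 2 * ((\<xi> + \<sigma> *\<^sub>R \<rho>) \<bullet> e)
      = 2 * (\<xi> \<bullet> \<rho>) + 2 * \<sigma> * (norm \<rho>)\<^sup>2 - 2 * \<sigma> * (b \<bullet> \<rho>) + \<sigma> * (2 * (b \<bullet> e))"
    unfolding power2_norm_eq_inner
    by (simp add: inner_add_left inner_diff_left inner_diff_right algebra_simps)
  moreover have "(2 - \<tau>) * \<sigma> * (norm \<rho>)\<^sup>2 = 2 * \<sigma> * (norm \<rho>)\<^sup>2 - \<tau> * \<sigma> * (norm \<rho>)\<^sup>2"
    by (simp add: left_diff_distrib)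
  ultimately show ?thesis
    using Y Z x be
    unfolding E_def b_def[symmetric] e_def[symmetric] \<rho>_def[symmetric] \<xi>_def[symmetric]
    by linarith
qed

text \<open>Monotonicity between consecutive \<open>z\<close>-inclusions. Substituting the
  multiplier update leaves the old residual with factor 1 - \<tau>, and the gradient loss is
  absorbed by \<open>sqnorm Q (d - a)\<close>, which the three-term expansion turns into a
  difference of consecutive increments.\<close>

lemma cross_term_estimate:
  "2 * \<sigma> * (B' (dz (Suc j)) \<bullet> r (Suc (Suc j))) + sqnorm Q (dz (Suc j))
    \<le> 2 * \<sigma> * (1 - \<tau>) * (B' (dz (Suc j)) \<bullet> r (Suc j)) + sqnorm Q (dz j)"
proof -
  define a where "a = dz j"
  define d where "d = dz (Suc j)"
  let ?\<gamma> = "grad g (z (Suc j)) - grad g (z j)"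
  have "0 \<le> (- (grad g (z (Suc j)) + (B (x (Suc j)) + \<sigma> *\<^sub>R B (r (Suc (Suc j)))) + Q d)
      - - (grad g (z j) + (B (x j) + \<sigma> *\<^sub>R B (r (Suc j))) + Q a)) \<bullet> d"
    unfolding a_def d_def by (rule subdiff_monotone[OF q z_step z_step])
  moreover have "B v \<bullet> d = B' d \<bullet> v" for v
    by (metis inner_adjoint[OF B] inner_commute)
  ultimately have "?\<gamma> \<bullet> d + \<sigma> * (B' d \<bullet> r (Suc (Suc j))) - (1 - \<tau>) * \<sigma> * (B' d \<bullet> r (Suc j))
      + Q d \<bullet> d - Q a \<bullet> d \<le> 0"
    by (simp add: x_Suc linear_add[OF B] linear_cmul[OF B] inner_add_left inner_diff_left algebra_simps)
  \<comment> \<open>The test point \<open>z j + d\<close> differs from \<open>z j\<close> by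
    \<open>d\<close> and from \<open>z (Suc j)\<close> by \<open>d - a\<close>.\<close>
  moreover have "- (1/4) * sqnorm \<Sigma>g (d - a) \<le> ?\<gamma> \<bullet> d"
    using majorizes_inner_grad_diff_ge[OF g(1,2) \<Sigma>g_self_adjoint \<Sigma>g(2), of "z j + d" "z (Suc j)" "z j"]
    by (simp add: a_def algebra_simps)
  moreover have "1/2 * sqnorm \<Sigma>g (d - a) \<le> sqnorm Q (d - a)"
    by (rule half_\<Sigma>g_le)
  moreover have "sqnorm Q (d - a) = sqnorm Q d - 2 * (Q a \<bullet> d) + sqnorm Q a"
    by (rule sqnorm_diff[OF Q_self_adjoint])
  ultimately show ?thesis
    unfolding a_def[symmetric] d_def[symmetric] by (simp add: sqnorm_def inner_commute algebra_simps)
qed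

text \<open>KKT points satisfy the constraint, so the coupling term of \<open>M\<close> is the
  residual itself, whichever KKT point is chosen.\<close>

lemma sqnorm_M_residual:
  assumes "(ybar, zbar, xbar) \<in> \<Omega>"
  shows "sqnorm M (u k - (ybar, zbar, xbar))
    = sqnorm P (y k - ybar) + sqnorm Q (z k - zbar) + \<sigma> * (norm (B' (z k - zbar)))\<^sup>2
      + inverse (\<tau> * \<sigma>) * (norm (x k - xbar))\<^sup>2 + s_tau \<tau> * \<sigma> * (norm (r k))\<^sup>2"
proof -
  have "A' (y k - ybar) + B' (z k - zbar) = r k"
    using assms by (simp add: KKT_points_iff r_def linear_diff[OF A'_linear] linear_diff[OF B'_linear]
      algebra_simps)
  then show ?thesis
    by (simp add: sqnorm_Mop[OF A B])
qed

text \<open>At \<open>k = 0\<close> the truncated subtraction makes the second term vanish.\<close>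
definition Lyap :: "'y \<times> 'z \<times> 'x \<Rightarrow> nat \<Rightarrow> real" where
  "Lyap v k = sqnorm M (u k - v) + sqnorm Q (z k - z (k - 1))"

text \<open>Adding the one-step and cross-term estimates leaves a positive definite form in
  \<open>B' (dz k)\<close> and \<open>r k\<close>, and the coefficient 2 - \<tau> -
  \<open>s_tau \<tau>\<close> on the new residual. The strict operator conditions then recover the
  full increments. The constant \<kappa> is the same for all KKT points.\<close>

lemma Lyap_descent:
  obtains \<kappa> where "\<kappa> > 0"
    "\<And>v k. v \<in> \<Omega> \<Longrightarrow> 1 \<le> k \<Longrightarrow> Lyap v (Suc k) + \<kappa> * (norm (step k))\<^sup>2 \<le> Lyap v k"
proof -
  obtain \<delta>0 where \<delta>0: "\<delta>0 > 0" "\<And>a b :: 'x. \<delta>0 * ((norm a)\<^sup>2 + (norm b)\<^sup>2)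
      \<le> (norm b)\<^sup>2 + s_tau \<tau> * (norm a)\<^sup>2 - 2 * (1 - \<tau>) * (b \<bullet> a)"
    using cross_term_lower_bound[OF s_tau_bounds(1)[OF \<tau>]] by blast
  obtain m1 where m1: "m1 > 0" "\<And>v. m1 * (norm v)\<^sup>2 \<le> sqnorm P v - 1/2 * sqnorm \<Sigma>f v + \<sigma> * (norm (A' v))\<^sup>2"
    using sqnorm_lower_bound_if_loewner_gt[OF A S(3)] by blast
  obtain m2 where m2: "m2 > 0" "\<And>w. m2 * (norm w)\<^sup>2 \<le> sqnorm Q w - 1/2 * sqnorm \<Sigma>g w + \<sigma> * (norm (B' w))\<^sup>2"
    using sqnorm_lower_bound_if_loewner_gt[OF B T(3)] by blast
  define \<delta> where "\<delta> = min \<delta>0 (2 - \<tau> - s_tau \<tau>)"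
  have \<delta>: "\<delta> > 0" "\<delta> \<le> \<delta>0" "\<delta> \<le> 2 - \<tau> - s_tau \<tau>"
    using \<delta>0(1) s_tau_bounds(2)[OF \<tau>] by (auto simp: \<delta>_def)
  \<comment> \<open>Five copies of \<open>\<epsilon> * (\<sigma> * N)\<close> are spent below: three
    on \<open>dy k\<close>, one on \<open>dz k\<close>, one on the residual. The factor 9 leaves
    room, and \<epsilon> \<le> 1 keeps the shares of \<open>a\<close> and \<open>d\<close>
    affordable.\<close>
  define \<epsilon> where "\<epsilon> = min 1 (\<delta> / 9)"
  have \<epsilon>: "0 < \<epsilon>" "\<epsilon> \<le> 1" "9 * \<epsilon> \<le> \<delta>"
    using \<delta>(1) by (auto simp: \<epsilon>_def)
  define \<kappa> where "\<kappa> = \<epsilon> * min m1 (min m2 \<sigma>)"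
  have \<kappa>: "0 < \<kappa>" "\<kappa> \<le> \<epsilon> * m1" "\<kappa> \<le> \<epsilon> * m2" "\<kappa> \<le> \<epsilon> * \<sigma>"
    using \<epsilon>(1) m1(1) m2(1) \<sigma> unfolding \<kappa>_def
    by (auto intro!: mult_pos_pos mult_left_mono)
  have "Lyap v (Suc k) + \<kappa> * (norm (step k))\<^sup>2 \<le> Lyap v k" if v: "v \<in> \<Omega>" and k: "1 \<le> k" for v k
  proof -
    obtain ybar zbar xbar where v_eq: "v = (ybar, zbar, xbar)"
      by (cases v)
    \<comment> \<open>The cross-term estimate needs a preceding \<open>z\<close>-inclusion, hence
      the descent starts at index 1.\<close>
    obtain j where j: "k = Suc j"
      using k by (cases k) auto
    define a where "a = sqnorm P (dy k) - 1/2 * sqnorm \<Sigma>f (dy k)"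
    define d where "d = sqnorm Q (dz k) - 1/2 * sqnorm \<Sigma>g (dz k)"
    define b where "b = B' (dz k)"
    have ad: "0 \<le> a" "0 \<le> d"
      using half_\<Sigma>f_le[of "dy k"] half_\<Sigma>g_le[of "dz k"] by (simp_all add: a_def d_def)
    define N where "N = (norm b)\<^sup>2 + (norm (r (Suc k)))\<^sup>2 + (norm (r k))\<^sup>2"
    have "\<delta> * N \<le> (norm b)\<^sup>2 + s_tau \<tau> * (norm (r k))\<^sup>2 - 2 * (1 - \<tau>) * (b \<bullet> r k)
        + (2 - \<tau> - s_tau \<tau>) * (norm (r (Suc k)))\<^sup>2"
    proof -
      have "\<delta> * ((norm (r k))\<^sup>2 + (norm b)\<^sup>2) \<le> \<delta>0 * ((norm (r k))\<^sup>2 + (norm b)\<^sup>2)"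
        "\<delta> * (norm (r (Suc k)))\<^sup>2 \<le> (2 - \<tau> - s_tau \<tau>) * (norm (r (Suc k)))\<^sup>2"
        using \<delta> by (auto intro!: mult_right_mono)
      with \<delta>0(2)[of "r k" b] show ?thesis
        by (simp add: N_def algebra_simps)
    qed
    then have "\<sigma> * (\<delta> * N) \<le> \<sigma> * ((norm b)\<^sup>2 + s_tau \<tau> * (norm (r k))\<^sup>2 - 2 * (1 - \<tau>) * (b \<bullet> r k)
        + (2 - \<tau> - s_tau \<tau>) * (norm (r (Suc k)))\<^sup>2)"
      using \<sigma> by (intro mult_left_mono) auto
    with one_step_estimate[OF v[unfolded v_eq], of k] cross_term_estimate[of j]
    have main: "Lyap v (Suc k) + a + d + \<sigma> * (\<delta> * N) \<le> Lyap v k"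
      unfolding Lyap_def v_eq sqnorm_M_residual[OF v[unfolded v_eq]]
        j[symmetric] a_def[symmetric] d_def[symmetric] b_def[symmetric]
      by (simp add: j algebra_simps)
    have N: "(norm b)\<^sup>2 \<le> N" "(norm (r (Suc k)))\<^sup>2 \<le> N" "(norm (A' (dy k)))\<^sup>2 \<le> 3 * N"
    proof -
      \<comment> \<open>The increment of \<open>A' y\<close> is controlled only through the two
        residuals and \<open>b\<close>; squaring a sum of three terms costs the factor 3.\<close>
      have "A' (dy k) = r (Suc k) - r k - b"
        by (simp add: r_def b_def linear_diff[OF A'_linear] linear_diff[OF B'_linear])
      then have "norm (A' (dy k)) \<le> norm (r (Suc k)) + norm (r k) + norm b"
        using norm_triangle_ineq4[of "r (Suc k) - r k" b] norm_triangle_ineq4[of "r (Suc k)" "r k"]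
        by simp
      then have "(norm (A' (dy k)))\<^sup>2 \<le> (norm (r (Suc k)) + norm (r k) + norm b)\<^sup>2"
        by (intro power_mono) auto
      also have "\<dots> \<le> 3 * N"
        using zero_le_power2[of "norm (r (Suc k)) - norm (r k)"]
          zero_le_power2[of "norm (r (Suc k)) - norm b"] zero_le_power2[of "norm (r k) - norm b"]
        by (simp add: N_def power2_eq_square algebra_simps)
      finally show "(norm (A' (dy k)))\<^sup>2 \<le> 3 * N" .
    qed (auto simp: N_def)
    have "\<kappa> * (norm (dy k))\<^sup>2 \<le> \<epsilon> * (m1 * (norm (dy k))\<^sup>2)"
      unfolding mult.assoc[symmetric] using \<kappa> by (intro mult_right_mono) auto
    also have "\<dots> \<le> \<epsilon> * (a + \<sigma> * (norm (A' (dy k)))\<^sup>2)"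
      unfolding a_def using m1(2)[of "dy k"] \<epsilon> by (intro mult_left_mono) auto
    also have "\<dots> \<le> \<epsilon> * (a + \<sigma> * (3 * N))"
      using N \<epsilon> \<sigma> by (intro mult_left_mono add_left_mono) auto
    finally have Y: "\<kappa> * (norm (dy k))\<^sup>2 \<le> \<epsilon> * a + 3 * (\<epsilon> * (\<sigma> * N))"
      by (simp add: algebra_simps)
    have "\<kappa> * (norm (dz k))\<^sup>2 \<le> \<epsilon> * (m2 * (norm (dz k))\<^sup>2)"
      unfolding mult.assoc[symmetric] using \<kappa> by (intro mult_right_mono) auto
    also have "\<dots> \<le> \<epsilon> * (d + \<sigma> * (norm b)\<^sup>2)"
      unfolding d_def b_def using m2(2)[of "dz k"] \<epsilon> by (intro mult_left_mono) auto
    also have "\<dots> \<le> \<epsilon> * (d + \<sigma> * N)"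
      using N \<epsilon> \<sigma> by (intro mult_left_mono add_left_mono) auto
    finally have Z: "\<kappa> * (norm (dz k))\<^sup>2 \<le> \<epsilon> * d + \<epsilon> * (\<sigma> * N)"
      by (simp add: algebra_simps)
    have "\<kappa> * (norm (r (Suc k)))\<^sup>2 \<le> \<epsilon> * \<sigma> * N"
      using \<kappa> N \<epsilon> \<sigma> by (intro mult_mono) auto
    moreover have "(norm (step k))\<^sup>2 = (norm (dy k))\<^sup>2 + (norm (dz k))\<^sup>2 + (norm (r (Suc k)))\<^sup>2"
      by (simp add: step_def norm_Pair)
    moreover have "\<epsilon> * a \<le> a" "\<epsilon> * d \<le> d"
      using \<epsilon> ad by (auto intro: mult_left_le_one_le)
    moreover have "0 \<le> \<sigma> * N"
      using \<sigma> by (simp add: N_def)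
    then have "9 * \<epsilon> * (\<sigma> * N) \<le> \<delta> * (\<sigma> * N)" "0 \<le> \<epsilon> * (\<sigma> * N)"
      using \<epsilon> by (auto intro!: mult_right_mono mult_nonneg_nonneg)
    ultimately show ?thesis
      using main Y Z by (simp add: algebra_simps)
  qed
  with \<kappa>(1) show thesis
    by (rule that)
qed

section \<open>Convergence and linear rate\<close>

lemma M_linear: "linear M"
  using linear_Mop[OF A B] \<Sigma>f_self_adjoint \<Sigma>g_self_adjoint S(1) T(1)
  by (simp add: self_adjointD)

text \<open>All terms of the form are nonnegative, so failure of positivity makes each vanish. Then
  \<open>A' a\<close> and \<open>B' b\<close> are zero, and the strict operator conditions force
  \<open>a\<close> and \<open>b\<close> to be zero.\<close>

lemma sqnorm_M_pos:
  assumes "v \<noteq> 0"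
  shows "0 < sqnorm M v"
proof (rule ccontr)
  assume neg: "\<not> 0 < sqnorm M v"
  obtain a b d where v: "v = (a, b, d)"
    by (cases v)
  obtain m1 where m1: "m1 > 0" "\<And>v. m1 * (norm v)\<^sup>2 \<le> sqnorm P v - 1/2 * sqnorm \<Sigma>f v + \<sigma> * (norm (A' v))\<^sup>2"
    using sqnorm_lower_bound_if_loewner_gt[OF A S(3)] by blast
  obtain m2 where m2: "m2 > 0" "\<And>w. m2 * (norm w)\<^sup>2 \<le> sqnorm Q w - 1/2 * sqnorm \<Sigma>g w + \<sigma> * (norm (B' w))\<^sup>2"
    using sqnorm_lower_bound_if_loewner_gt[OF B T(3)] by blast
  have nonneg: "0 \<le> sqnorm \<Sigma>f a" "0 \<le> sqnorm \<Sigma>g b"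
    using \<Sigma>f \<Sigma>g by (auto simp: psd_def sqnorm_def)
  have terms: "0 \<le> sqnorm P a" "0 \<le> sqnorm Q b" "0 \<le> \<sigma> * (norm (B' b))\<^sup>2"
    "0 \<le> inverse (\<tau> * \<sigma>) * (norm d)\<^sup>2" "0 \<le> s_tau \<tau> * \<sigma> * (norm (A' a + B' b))\<^sup>2"
    using sqnorm_P_nonneg sqnorm_Q_nonneg \<tau> \<sigma> s_tau_pos by auto
  with neg have zero: "sqnorm P a = 0" "sqnorm Q b = 0" "\<sigma> * (norm (B' b))\<^sup>2 = 0"
    "inverse (\<tau> * \<sigma>) * (norm d)\<^sup>2 = 0" "s_tau \<tau> * \<sigma> * (norm (A' a + B' b))\<^sup>2 = 0"
    unfolding v sqnorm_Mop[OF A B] by linarith+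
  then have "d = 0" "B' b = 0" "A' a + B' b = 0"
    using \<tau> \<sigma> s_tau_pos by simp_all
  then have "A' a = 0"
    by simp
  have "m1 * (norm a)\<^sup>2 \<le> 0" "m2 * (norm b)\<^sup>2 \<le> 0"
    using m1(2)[of a] m2(2)[of b] nonneg zero \<open>A' a = 0\<close> \<open>B' b = 0\<close> by simp_all
  then have "a = 0" "b = 0"
    using m1(1) m2(1) by (simp_all add: mult_le_0_iff)
  with \<open>d = 0\<close> v assms show False
    by (simp add: zero_prod_def)
qed

lemma sqnorm_M_nonneg: "0 \<le> sqnorm M v"
  using sqnorm_M_pos[of v] by (cases "v = 0") (auto simp: sqnorm_def)

lemma grad_f_continuous: "continuous_on UNIV (grad f)" and grad_g_continuous: "continuous_on UNIV (grad g)"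
  using f(3) g(3) lipschitz_on_continuous_on by blast+

lemma norm_step_components:
  "norm (dy k) \<le> norm (step k)" "norm (dz k) \<le> norm (step k)" "norm (r (Suc k)) \<le> norm (step k)"
  unfolding step_def using norm_fst_le norm_snd_le order_trans by metis+

text \<open>Replacing old gradients and multipliers by new ones in the inclusions causes a Lipschitz
  error plus a linear function of the step; \<open>norm_diff_prox_le\<close> transfers this error to
  the KKT mapping.\<close>

lemma KKT_map_residual_bound:
  "\<exists>C>0. \<forall>k. norm (KKT_map p f q g A B c (u (Suc k))) \<le> C * norm (step k)"
proof -
  obtain Lf Lg where L: "Lf-lipschitz_on UNIV (grad f)" "Lg-lipschitz_on UNIV (grad g)"
    using f(3) g(3) by blast
  \<comment> \<open>The maps \<open>hy\<close> and \<open>hz\<close> collect the linear parts of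
    these errors, with the multiplier increment written through the new residual.\<close>
  define hy where "hy = (\<lambda>(a, b, d). A ((\<tau> * \<sigma>) *\<^sub>R d) - \<sigma> *\<^sub>R A (d - B' b) - P a)"
  define hz where "hz = (\<lambda>(a :: 'y, b, d). B ((\<tau> * \<sigma>) *\<^sub>R d) - \<sigma> *\<^sub>R B d - Q b)"
  have lin: "linear \<Sigma>f" "linear S" "linear \<Sigma>g" "linear T"
    using \<Sigma>f_self_adjoint \<Sigma>g_self_adjoint S(1) T(1) by (auto intro: self_adjointD)
  note linear_simps = lin[THEN linear_add] lin[THEN linear_cmul]
    A[THEN linear_add] A[THEN linear_diff] A[THEN linear_cmul]
    B[THEN linear_add] B[THEN linear_cmul] B'_linear[THEN linear_add] B'_linear[THEN linear_cmul]
  have "linear hy"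
    by (intro linearI) (auto simp: hy_def linear_simps algebra_simps)
  then obtain Ky where Ky: "Ky > 0" "\<And>v. norm (hy v) \<le> Ky * norm v"
    using linear_norm_bound by blast
  have "linear hz"
    by (intro linearI) (auto simp: hz_def linear_simps algebra_simps)
  then obtain Kz where Kz: "Kz > 0" "\<And>v. norm (hz v) \<le> Kz * norm v"
    using linear_norm_bound by blast
  have "norm (KKT_map p f q g A B c (u (Suc k))) \<le> (Lf + Ky + (Lg + Kz) + 1) * norm (step k)" for k
  proof -
    let ?s = "- (grad f (y k) + (A (x k) + \<sigma> *\<^sub>R A (r (Suc k) - B' (dz k))) + P (dy k))"
    let ?e = "grad f (y (Suc k)) + A (x (Suc k))"
    have "?s + ?e = (grad f (y (Suc k)) - grad f (y k)) + hy (step k)"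
      by (simp add: hy_def step_def x_Suc linear_add[OF A])
    then have "norm (?s + ?e) \<le> norm (grad f (y (Suc k)) - grad f (y k)) + norm (hy (step k))"
      by (simp only: norm_triangle_ineq)
    also have "\<dots> \<le> Lf * norm (dy k) + Ky * norm (step k)"
      using lipschitz_onD[OF L(1), of "y (Suc k)" "y k"] Ky(2) by (intro add_mono) (simp_all add: dist_norm)
    also have "\<dots> \<le> Lf * norm (step k) + Ky * norm (step k)"
      using lipschitz_on_nonneg[OF L(1)] norm_step_components(1)[of k] by (simp add: mult_left_mono)
    finally have Y: "norm (y (Suc k) - prox p (y (Suc k) - ?e)) \<le> (Lf + Ky) * norm (step k)"
      using norm_diff_prox_le[OF p y_step, of k ?e] by (simp add: distrib_right)
    let ?s = "- (grad g (z k) + (B (x k) + \<sigma> *\<^sub>R B (r (Suc k))) + Q (dz k))"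
    let ?e' = "grad g (z (Suc k)) + B (x (Suc k))"
    have "?s + ?e' = (grad g (z (Suc k)) - grad g (z k)) + hz (step k)"
      by (simp add: hz_def step_def x_Suc linear_add[OF B])
    then have "norm (?s + ?e') \<le> norm (grad g (z (Suc k)) - grad g (z k)) + norm (hz (step k))"
      by (simp only: norm_triangle_ineq)
    also have "\<dots> \<le> Lg * norm (dz k) + Kz * norm (step k)"
      using lipschitz_onD[OF L(2), of "z (Suc k)" "z k"] Kz(2) by (intro add_mono) (simp_all add: dist_norm)
    also have "\<dots> \<le> Lg * norm (step k) + Kz * norm (step k)"
      using lipschitz_on_nonneg[OF L(2)] norm_step_components(2)[of k] by (simp add: mult_left_mono)
    finally have Z: "norm (z (Suc k) - prox q (z (Suc k) - ?e')) \<le> (Lg + Kz) * norm (step k)"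
      using norm_diff_prox_le[OF q z_step, of k ?e'] by (simp add: distrib_right)
    have "c - A' (y (Suc k)) - B' (z (Suc k)) = - r (Suc k)"
      by (simp add: r_def)
    then have R: "norm (c - A' (y (Suc k)) - B' (z (Suc k))) \<le> norm (step k)"
      using norm_step_components(3)[of k] by simp
    have "norm (KKT_map p f q g A B c (u (Suc k)))
        \<le> norm (y (Suc k) - prox p (y (Suc k) - ?e)) + (norm (z (Suc k) - prox q (z (Suc k) - ?e'))
          + norm (c - A' (y (Suc k)) - B' (z (Suc k))))"
      unfolding KKT_map_def prod.case by (intro order_trans[OF norm_Pair_le] add_mono order_refl norm_Pair_le)
    also have "\<dots> \<le> (Lf + Ky) * norm (step k) + ((Lg + Kz) * norm (step k) + norm (step k))"
      using Y Z R by (intro add_mono)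
    finally show ?thesis
      by (simp add: algebra_simps)
  qed
  moreover have "Lf + Ky + (Lg + Kz) + 1 > 0"
    using Ky(1) Kz(1) lipschitz_on_nonneg[OF L(1)] lipschitz_on_nonneg[OF L(2)] by linarith
  ultimately show ?thesis
    by blast
qed

text \<open>Covers finite termination, where the descent inequality is not strict.\<close>

lemma KKT_point_if_step_zero:
  assumes "step k = 0"
  shows "u (Suc k) \<in> \<Omega>"
proof -
  have zero: "y (Suc k) = y k" "z (Suc k) = z k" "r (Suc k) = 0"
    using assms by (simp_all add: step_def zero_prod_def)
  then have "x (Suc k) = x k"
    by (simp add: x_Suc)
  with zero y_step[of k] z_step[of k] show ?thesis
    using zero(3)[unfolded r_def]
    by (simp add: KKT_points_iff linear_0[OF A] linear_0[OF B] linear_0[OF B'_linear]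
        linear_0[OF P_linear] linear_0[OF Q_linear])
qed

section \<open>Convergence of the iterates\<close>

lemma Lyap_nonneg: "0 \<le> Lyap v k"
  using sqnorm_M_nonneg sqnorm_Q_nonneg by (simp add: Lyap_def)

lemma decseq_Lyap:
  assumes "v \<in> \<Omega>"
  shows "decseq (\<lambda>n. Lyap v (Suc n))"
proof -
  obtain \<kappa> where \<kappa>: "\<kappa> > 0"
    "\<And>v k. v \<in> \<Omega> \<Longrightarrow> 1 \<le> k \<Longrightarrow> Lyap v (Suc k) + \<kappa> * (norm (step k))\<^sup>2 \<le> Lyap v k"
    using Lyap_descent by blast
  have "Lyap v (Suc (Suc n)) \<le> Lyap v (Suc n)" for n
  proof -
    have "0 \<le> \<kappa> * (norm (step (Suc n)))\<^sup>2"
      using \<kappa>(1) by simp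
    with \<kappa>(2)[OF assms, of "Suc n"] show ?thesis
      by simp
  qed
  then show ?thesis
    by (rule decseq_SucI)
qed

lemma Lyap_convergent:
  assumes "v \<in> \<Omega>"
  obtains l where "(\<lambda>n. Lyap v (Suc n)) \<longlonglongrightarrow> l"
  using decseq_convergent[OF decseq_Lyap[OF assms], of 0] Lyap_nonneg by blast

text \<open>Successive differences of the convergent values of \<open>Lyap\<close> tend to zero and
  dominate a multiple of the squared step.\<close>

lemma step_tendsto_0: "step \<longlonglongrightarrow> 0"
proof -
  obtain v where v: "v \<in> \<Omega>"
    using KKT_nonempty by blast
  obtain \<kappa> where \<kappa>: "\<kappa> > 0"
    "\<And>v k. v \<in> \<Omega> \<Longrightarrow> 1 \<le> k \<Longrightarrow> Lyap v (Suc k) + \<kappa> * (norm (step k))\<^sup>2 \<le> Lyap v k"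
    using Lyap_descent by blast
  obtain l where l: "(\<lambda>n. Lyap v (Suc n)) \<longlonglongrightarrow> l"
    using Lyap_convergent[OF v] by blast
  have "(\<lambda>n. (Lyap v (Suc n) - Lyap v (Suc (Suc n))) / \<kappa>) \<longlonglongrightarrow> (l - l) / \<kappa>"
    using \<kappa>(1) by (intro tendsto_intros l LIMSEQ_Suc[OF l]) auto
  then have lim: "(\<lambda>n. (Lyap v (Suc n) - Lyap v (Suc (Suc n))) / \<kappa>) \<longlonglongrightarrow> 0"
    by simp
  have "(norm (step (Suc n)))\<^sup>2 \<le> (Lyap v (Suc n) - Lyap v (Suc (Suc n))) / \<kappa>" for n
    using \<kappa>(2)[OF v, of "Suc n"] \<kappa>(1) by (simp add: field_simps)
  then have "(\<lambda>n. (norm (step (Suc n)))\<^sup>2) \<longlonglongrightarrow> 0"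
    by (intro tendsto_sandwich[OF _ _ tendsto_const lim]) auto
  then have "(\<lambda>n. sqrt ((norm (step (Suc n)))\<^sup>2)) \<longlonglongrightarrow> sqrt 0"
    by (rule tendsto_real_sqrt)
  then have "(\<lambda>n. step (Suc n)) \<longlonglongrightarrow> 0"
    by (simp add: tendsto_norm_zero_iff)
  then show ?thesis
    by (rule LIMSEQ_imp_Suc)
qed

lemma dy_tendsto_0: "(\<lambda>k. dy k) \<longlonglongrightarrow> 0" and dz_tendsto_0: "(\<lambda>k. dz k) \<longlonglongrightarrow> 0"
  and r_tendsto_0: "(\<lambda>k. r (Suc k)) \<longlonglongrightarrow> 0"
  using tendsto_fst[OF step_tendsto_0] tendsto_fst[OF tendsto_snd[OF step_tendsto_0]]
    tendsto_snd[OF tendsto_snd[OF step_tendsto_0]]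
  by (simp_all add: step_def)

text \<open>Since the steps vanish, old and new iterates share the limit along the subsequence, and
  \<open>subdiff_closed\<close> passes to the limit in both inclusions.\<close>

lemma cluster_point_KKT:
  assumes \<phi>: "strict_mono \<phi>" and lim: "(\<lambda>n. u (\<phi> n)) \<longlonglongrightarrow> w"
  shows "w \<in> \<Omega>"
proof -
  obtain a b d where w: "w = (a, b, d)"
    by (cases w)
  have y: "(\<lambda>n. y (\<phi> n)) \<longlonglongrightarrow> a" and z: "(\<lambda>n. z (\<phi> n)) \<longlonglongrightarrow> b" and x: "(\<lambda>n. x (\<phi> n)) \<longlonglongrightarrow> d"
    using tendsto_fst[OF lim] tendsto_fst[OF tendsto_snd[OF lim]] tendsto_snd[OF tendsto_snd[OF lim]]
    by (simp_all add: w)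
  have dy: "(\<lambda>n. dy (\<phi> n)) \<longlonglongrightarrow> 0" and dz: "(\<lambda>n. dz (\<phi> n)) \<longlonglongrightarrow> 0"
    and r: "(\<lambda>n. r (Suc (\<phi> n))) \<longlonglongrightarrow> 0"
    using LIMSEQ_subseq_LIMSEQ[OF dy_tendsto_0 \<phi>] LIMSEQ_subseq_LIMSEQ[OF dz_tendsto_0 \<phi>]
      LIMSEQ_subseq_LIMSEQ[OF r_tendsto_0 \<phi>] by (simp_all add: o_def)
  have ySuc: "(\<lambda>n. y (Suc (\<phi> n))) \<longlonglongrightarrow> a" and zSuc: "(\<lambda>n. z (Suc (\<phi> n))) \<longlonglongrightarrow> b"
    using tendsto_add[OF y dy] tendsto_add[OF z dz] by simp_all
  have gf: "(\<lambda>n. grad f (y (\<phi> n))) \<longlonglongrightarrow> grad f a" and gg: "(\<lambda>n. grad g (z (\<phi> n))) \<longlonglongrightarrow> grad g b"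
    using continuous_on_tendsto_compose[OF grad_f_continuous y] continuous_on_tendsto_compose[OF grad_g_continuous z]
    by simp_all
  have "(\<lambda>n. - (grad f (y (\<phi> n)) + (A (x (\<phi> n)) + \<sigma> *\<^sub>R A (r (Suc (\<phi> n)) - B' (dz (\<phi> n)))) + P (dy (\<phi> n))))
      \<longlonglongrightarrow> - (grad f a + (A d + \<sigma> *\<^sub>R A (0 - B' 0)) + P 0)"
    by (intro tendsto_minus tendsto_add tendsto_scaleR tendsto_const tendsto_diff
        tendsto_linear[OF A] tendsto_linear[OF B'_linear] tendsto_linear[OF P_linear] gf x r dz dy)
  from subdiff_closed[OF p y_step ySuc this]
  have "- (grad f a + A d) \<in> subdiff p a"
    by (simp add: linear_0[OF A] linear_0[OF B'_linear] linear_0[OF P_linear])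
  moreover
  have "(\<lambda>n. - (grad g (z (\<phi> n)) + (B (x (\<phi> n)) + \<sigma> *\<^sub>R B (r (Suc (\<phi> n)))) + Q (dz (\<phi> n))))
      \<longlonglongrightarrow> - (grad g b + (B d + \<sigma> *\<^sub>R B 0) + Q 0)"
    by (intro tendsto_minus tendsto_add tendsto_scaleR tendsto_const
        tendsto_linear[OF B] tendsto_linear[OF Q_linear] gg x r dz)
  from subdiff_closed[OF q z_step zSuc this]
  have "- (grad g b + B d) \<in> subdiff q b"
    by (simp add: linear_0[OF B] linear_0[OF Q_linear])
  moreover
  have "(\<lambda>n. r (Suc (\<phi> n))) \<longlonglongrightarrow> A' a + B' b - c"
    unfolding r_def
    by (intro tendsto_diff tendsto_add tendsto_const tendsto_linear[OF A'_linear] tendsto_linear[OF B'_linear]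
        ySuc zSuc)
  with r have "A' a + B' b - c = 0"
    by (rule LIMSEQ_unique[rotated])
  ultimately show ?thesis
    by (simp add: w KKT_points_iff)
qed

text \<open>A Fejer-type argument: \<open>Lyap\<close> keeps the iterates bounded, a cluster point
  \<open>w\<close> is a KKT point, and the convergent values of \<open>Lyap w\<close> tend to zero
  along a subsequence, hence along the whole sequence.\<close>

lemma iterates_converge:
  obtains w where "w \<in> \<Omega>" "u \<longlonglongrightarrow> w"
proof -
  obtain m where m: "m > 0" "\<And>v. m * (norm v)\<^sup>2 \<le> sqnorm M v"
    using linear_quadratic_lower_bound[OF M_linear] sqnorm_M_pos unfolding sqnorm_def by blast
  have dist_le: "(norm (u k - v))\<^sup>2 \<le> Lyap v k / m" for v k
  proof -
    have "m * (norm (u k - v))\<^sup>2 \<le> Lyap v k"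
      using m(2)[of "u k - v"] sqnorm_Q_nonneg[of "z k - z (k - 1)"] by (simp add: Lyap_def)
    then show ?thesis
      using m(1) by (simp add: field_simps)
  qed
  obtain v where v: "v \<in> \<Omega>"
    using KKT_nonempty by blast
  have "u (Suc n) \<in> cball v (sqrt (Lyap v 1 / m))" for n
  proof -
    have "Lyap v (Suc n) \<le> Lyap v 1"
      using decseqD[OF decseq_Lyap[OF v], of 0 n] by simp
    then have "Lyap v (Suc n) / m \<le> Lyap v 1 / m"
      using m(1) by (simp add: divide_right_mono)
    with dist_le[of "Suc n" v] have "norm (u (Suc n) - v) \<le> sqrt (Lyap v 1 / m)"
      by (intro real_le_rsqrt) linarith
    then show ?thesis
      by (simp add: dist_norm norm_minus_commute)
  qed
  then obtain w \<phi> where \<phi>: "strict_mono (\<phi> :: nat \<Rightarrow> nat)" and lim: "((\<lambda>n. u (Suc n)) \<circ> \<phi>) \<longlonglongrightarrow> w"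
    using compact_imp_seq_compact[OF compact_cball[of v "sqrt (Lyap v 1 / m)"],
        unfolded seq_compact_def, rule_format, of "\<lambda>n. u (Suc n)"] by blast
  have w: "w \<in> \<Omega>"
    using \<phi> lim by (intro cluster_point_KKT[of "\<lambda>n. Suc (\<phi> n)"]) (auto simp: strict_mono_def o_def)
  obtain l where l: "(\<lambda>n. Lyap w (Suc n)) \<longlonglongrightarrow> l"
    using Lyap_convergent[OF w] by blast
  have "(\<lambda>n. u (Suc (\<phi> n)) - w) \<longlonglongrightarrow> w - w"
    using lim by (intro tendsto_diff tendsto_const) (simp add: o_def)
  moreover have "(\<lambda>n. dz (\<phi> n)) \<longlonglongrightarrow> 0"
    using LIMSEQ_subseq_LIMSEQ[OF dz_tendsto_0 \<phi>] by (simp add: o_def)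
  ultimately have "(\<lambda>n. sqnorm M (u (Suc (\<phi> n)) - w) + sqnorm Q (dz (\<phi> n)))
      \<longlonglongrightarrow> (w - w) \<bullet> M (w - w) + 0 \<bullet> Q 0"
    unfolding sqnorm_def by (intro tendsto_add tendsto_inner tendsto_linear[OF M_linear] tendsto_linear[OF Q_linear])
  then have "(\<lambda>n. Lyap w (Suc (\<phi> n))) \<longlonglongrightarrow> 0"
    by (simp add: Lyap_def)
  then have "l = 0"
    using LIMSEQ_subseq_LIMSEQ[OF l \<phi>] by (intro LIMSEQ_unique) (auto simp: o_def)
  with l have Lyap_0: "(\<lambda>n. Lyap w (Suc n) / m) \<longlonglongrightarrow> 0"
    using tendsto_divide_zero by blast
  define e where "e n = norm (u (Suc n) - w)" for n
  have "(e n)\<^sup>2 \<le> Lyap w (Suc n) / m" for n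
    unfolding e_def by (rule dist_le)
  then have "(\<lambda>n. (e n)\<^sup>2) \<longlonglongrightarrow> 0"
    by (intro tendsto_sandwich[OF _ _ tendsto_const Lyap_0]) auto
  then have "(\<lambda>n. sqrt ((e n)\<^sup>2)) \<longlonglongrightarrow> sqrt 0"
    by (rule tendsto_real_sqrt)
  then have "(\<lambda>n. norm (u (Suc n) - w)) \<longlonglongrightarrow> 0"
    by (simp only: e_def real_sqrt_abs abs_norm_cancel real_sqrt_zero)
  then have "(\<lambda>n. u (Suc n)) \<longlonglongrightarrow> w"
    by (rule LIM_zero_cancel[OF tendsto_norm_zero_cancel])
  then have "u \<longlonglongrightarrow> w"
    by (rule LIMSEQ_imp_Suc)
  with w show thesis
    by (rule that)
qed

lemma optimal_limit:
  "\<exists>ybar zbar xbar. (\<lambda>k. (y k, z k)) \<longlonglongrightarrow> (ybar, zbar) \<and> primal_optimal p f q g A B c (ybar, zbar) \<and>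
     x \<longlonglongrightarrow> xbar \<and> dual_optimal p f q g A B c xbar"
proof -
  obtain w where w: "w \<in> \<Omega>" "u \<longlonglongrightarrow> w"
    by (rule iterates_converge)
  obtain ybar zbar xbar where w_eq: "w = (ybar, zbar, xbar)"
    by (cases w)
  have "y \<longlonglongrightarrow> ybar" "z \<longlonglongrightarrow> zbar" "x \<longlonglongrightarrow> xbar"
    using tendsto_fst[OF w(2)] tendsto_fst[OF tendsto_snd[OF w(2)]] tendsto_snd[OF tendsto_snd[OF w(2)]]
    by (simp_all add: w_eq)
  moreover note KKT_point_optimal[OF p q f(1,2) g(1,2) A B w(1)[unfolded w_eq]]
  ultimately show ?thesis
    by (intro exI conjI tendsto_Pair)
qed

section \<open>The merit values and their linear rate\<close>

definition merit :: "nat \<Rightarrow> real" where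
  "merit k = (op_dist M (u k) \<Omega>)\<^sup>2 + sqnorm Q (z k - z (k - 1))"

lemma merit_nonneg: "0 \<le> merit k"
  using sqnorm_Q_nonneg by (simp add: merit_def)

text \<open>As \<kappa> is independent of the KKT point, the infimum over all of them can be taken
  in the descent inequality; no nearest point is selected.\<close>

lemma merit_descent:
  "\<exists>\<kappa>>0. \<forall>k\<ge>1. merit (Suc k) + \<kappa> * (norm (step k))\<^sup>2 \<le> merit k"
proof -
  obtain \<kappa> where \<kappa>: "\<kappa> > 0"
    "\<And>v k. v \<in> \<Omega> \<Longrightarrow> 1 \<le> k \<Longrightarrow> Lyap v (Suc k) + \<kappa> * (norm (step k))\<^sup>2 \<le> Lyap v k"
    using Lyap_descent by blast
  have "merit (Suc k) + \<kappa> * (norm (step k))\<^sup>2 \<le> merit k" if k: "1 \<le> k" for k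
  proof -
    have "merit (Suc k) + \<kappa> * (norm (step k))\<^sup>2 - sqnorm Q (z k - z (k - 1)) \<le> sqnorm M (u k - v)"
      if v: "v \<in> \<Omega>" for v
      using op_dist_sq_le[OF sqnorm_M_nonneg v, of "u (Suc k)"] \<kappa>(2)[OF v k]
      by (simp add: merit_def Lyap_def)
    from le_op_dist_sq[OF KKT_nonempty this] show ?thesis
      by (simp add: merit_def)
  qed
  with \<kappa>(1) show ?thesis
    by blast
qed

lemma merit_zero_if_step_zero:
  assumes "step k = 0"
  shows "merit (Suc k) = 0"
proof -
  have "(op_dist M (u (Suc k)) \<Omega>)\<^sup>2 \<le> sqnorm M (u (Suc k) - u (Suc k))"
    by (rule op_dist_sq_le[OF sqnorm_M_nonneg KKT_point_if_step_zero[OF assms]])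
  moreover have "z (Suc k) = z k"
    using assms by (simp add: step_def zero_prod_def)
  ultimately show ?thesis
    by (simp add: merit_def sqnorm_def)
qed

text \<open>Once the iterates stay within the subregularity radius, the distance to the KKT set is
  bounded by the KKT residual and thus by the step.\<close>

lemma merit_le_step:
  assumes lim: "u \<longlonglongrightarrow> ubar" and \<eta>: "0 < \<eta>" and sub: "KKT_map_subregular p f q g A B c ubar \<eta>"
  shows "\<exists>D>0. \<exists>k0\<ge>1. \<forall>k\<ge>k0. merit (Suc k) \<le> D * (norm (step k))\<^sup>2"
proof -
  obtain C where C: "C > 0" "\<And>k. norm (KKT_map p f q g A B c (u (Suc k))) \<le> C * norm (step k)"
    using KKT_map_residual_bound by blast
  obtain CM where CM: "CM > 0" "\<And>v. sqnorm M v \<le> CM * (norm v)\<^sup>2"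
    using linear_quadratic_upper_bound[OF M_linear] unfolding sqnorm_def by blast
  obtain CQ where CQ: "CQ > 0" "\<And>w. sqnorm Q w \<le> CQ * (norm w)\<^sup>2"
    using linear_quadratic_upper_bound[OF Q_linear] unfolding sqnorm_def by blast
  obtain \<rho> where \<rho>: "\<rho> > 0" "\<And>v. norm (v - ubar) \<le> \<rho> \<Longrightarrow> infdist v \<Omega> \<le> \<eta> * norm (KKT_map p f q g A B c v)"
    using sub unfolding KKT_map_subregular_def by blast
  obtain N where N: "\<And>n. n \<ge> N \<Longrightarrow> norm (u n - ubar) < \<rho>"
    using LIMSEQ_D[OF lim \<rho>(1)] by blast
  have "merit (Suc k) \<le> (CM * (\<eta> * C)\<^sup>2 + CQ) * (norm (step k))\<^sup>2" if k: "k \<ge> max 1 N" for k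
  proof -
    have "infdist (u (Suc k)) \<Omega> \<le> \<eta> * norm (KKT_map p f q g A B c (u (Suc k)))"
      using N[of "Suc k"] k by (intro \<rho>(2)) auto
    also have "\<dots> \<le> \<eta> * (C * norm (step k))"
      using C(2) \<eta> by (intro mult_left_mono) auto
    finally have "(infdist (u (Suc k)) \<Omega>)\<^sup>2 \<le> (\<eta> * (C * norm (step k)))\<^sup>2"
      by (intro power_mono infdist_nonneg)
    then have "CM * (infdist (u (Suc k)) \<Omega>)\<^sup>2 \<le> CM * (\<eta> * (C * norm (step k)))\<^sup>2"
      using CM(1) by (intro mult_left_mono) auto
    with op_dist_sq_le_infdist[OF sqnorm_M_nonneg CM KKT_nonempty, of "u (Suc k)"]
    have "(op_dist M (u (Suc k)) \<Omega>)\<^sup>2 \<le> CM * (\<eta> * C)\<^sup>2 * (norm (step k))\<^sup>2"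
      by (simp add: power_mult_distrib mult_ac)
    moreover have "sqnorm Q (dz k) \<le> CQ * (norm (step k))\<^sup>2"
      using CQ(2)[of "dz k"] CQ(1) norm_step_components(2)[of k]
      by (intro order_trans[OF CQ(2)] mult_left_mono power_mono) auto
    ultimately show ?thesis
      by (simp add: merit_def distrib_right)
  qed
  moreover have "CM * (\<eta> * C)\<^sup>2 + CQ > 0"
    using CM(1) CQ(1) by (intro add_nonneg_pos) auto
  moreover have "max 1 N \<ge> 1"
    by simp
  ultimately show ?thesis
    by blast
qed

lemma linear_rate:
  assumes "u \<longlonglongrightarrow> ubar" "0 < \<eta>" "KKT_map_subregular p f q g A B c ubar \<eta>"
  shows "\<exists>\<mu>. 0 < \<mu> \<and> \<mu> < 1 \<and> (\<exists>k0\<ge>1. \<forall>k\<ge>k0. merit (k + 1) \<le> \<mu> * merit k) \<and>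
      (\<exists>\<mu>hat. \<mu> \<le> \<mu>hat \<and> \<mu>hat < 1 \<and> (\<forall>k\<ge>1. merit (k + 1) \<le> \<mu>hat * merit k))"
proof -
  obtain \<kappa> where \<kappa>: "\<kappa> > 0" "\<And>k. k \<ge> 1 \<Longrightarrow> merit (Suc k) + \<kappa> * (norm (step k))\<^sup>2 \<le> merit k"
    using merit_descent by blast
  obtain D k0 where D: "D > 0" and k0: "k0 \<ge> 1" "\<And>k. k \<ge> k0 \<Longrightarrow> merit (Suc k) \<le> D * (norm (step k))\<^sup>2"
    using merit_le_step[OF assms] by blast
  \<comment> \<open>Adding \<kappa> times the error bound to \<open>D\<close> times the descent
    inequality eliminates the step and gives this factor.\<close>
  define \<mu> where "\<mu> = D / (D + \<kappa>)"
  have \<mu>: "0 < \<mu>" "\<mu> < 1"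
    using D \<kappa>(1) by (auto simp: \<mu>_def)
  have tail: "merit (k + 1) \<le> \<mu> * merit k" if k: "k \<ge> k0" for k
  proof -
    have "\<kappa> * merit (Suc k) \<le> \<kappa> * (D * (norm (step k))\<^sup>2)"
      using k0(2)[OF k] \<kappa>(1) by (intro mult_left_mono) auto
    moreover have "D * (merit (Suc k) + \<kappa> * (norm (step k))\<^sup>2) \<le> D * merit k"
      using \<kappa>(2)[of k] k k0(1) D by (intro mult_left_mono) auto
    ultimately have "(D + \<kappa>) * merit (Suc k) \<le> D * merit k"
      by (simp add: algebra_simps)
    then show ?thesis
      using D \<kappa>(1) by (simp add: \<mu>_def field_simps)
  qed
  \<comment> \<open>Early indices may lie outside the subregularity region, so only strict decrease
    is available there; a zero step gives merit zero instead.\<close>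
  have strict: "merit (k + 1) = 0 \<or> merit (k + 1) < merit k" if k: "1 \<le> k" for k
  proof (cases "step k = 0")
    case False
    then have "0 < \<kappa> * (norm (step k))\<^sup>2"
      using \<kappa>(1) by simp
    with \<kappa>(2)[OF k] show ?thesis
      by simp
  qed (use merit_zero_if_step_zero in simp)
  from uniform_contraction_factor[of merit, OF merit_nonneg strict tail \<mu>(2)]
  show ?thesis
    using \<mu> tail k0(1) by blast
qed

end

theorem theorem3p1:
  fixes p :: "'y::euclidean_space \<Rightarrow> ereal" and f :: "'y \<Rightarrow> real"
    and q :: "'z::euclidean_space \<Rightarrow> ereal" and g :: "'z \<Rightarrow> real"
    and A :: "'x::euclidean_space \<Rightarrow> 'y" and B :: "'x \<Rightarrow> 'z" and c :: 'x
    and \<Sigma>f S :: "'y \<Rightarrow> 'y" and \<Sigma>g T :: "'z \<Rightarrow> 'z"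
    and \<sigma> \<tau> :: real
    and y :: "nat \<Rightarrow> 'y" and z :: "nat \<Rightarrow> 'z" and x :: "nat \<Rightarrow> 'x"
  assumes f: "convex_on UNIV f" "f differentiable_on UNIV" "\<exists>L. L-lipschitz_on UNIV (grad f)"
    and g: "convex_on UNIV g" "g differentiable_on UNIV" "\<exists>L. L-lipschitz_on UNIV (grad g)"
    and p: "closed_proper_convex p" and q: "closed_proper_convex q"
    and A: "linear A" and B: "linear B"
    and \<Sigma>f: "psd \<Sigma>f" "majorizes \<Sigma>f f"
    and \<Sigma>g: "psd \<Sigma>g" "majorizes \<Sigma>g g"
    and KKT_nonempty: "KKT_points p f q g A B c \<noteq> {}"
    and \<tau>: "0 < \<tau>" "\<tau> < (1 + sqrt 5) / 2" and \<sigma>: "0 < \<sigma>"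
    and S: "self_adjoint S" "S \<succeq>\<^sub>L (\<lambda>v. - (1/2) *\<^sub>R \<Sigma>f v)"
           "(\<lambda>v. (1/2) *\<^sub>R \<Sigma>f v + S v + \<sigma> *\<^sub>R A (adjoint A v)) \<succ>\<^sub>L (\<lambda>_. 0)"
    and T: "self_adjoint T" "T \<succeq>\<^sub>L (\<lambda>w. - (1/2) *\<^sub>R \<Sigma>g w)"
           "(\<lambda>w. (1/2) *\<^sub>R \<Sigma>g w + T w + \<sigma> *\<^sub>R B (adjoint B w)) \<succ>\<^sub>L (\<lambda>_. 0)"
    and seq: "majorized_iPADMM p f q g A B c \<Sigma>f \<Sigma>g S T \<sigma> \<tau> y z x"
  shows
    "(\<exists>ybar zbar xbar.
        (\<lambda>k. (y k, z k)) \<longlonglongrightarrow> (ybar, zbar) \<and> primal_optimal p f q g A B c (ybar, zbar) \<and>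
        x \<longlonglongrightarrow> xbar \<and> dual_optimal p f q g A B c xbar)
     \<and>
     (\<forall>ubar \<eta>.
        ubar \<in> KKT_points p f q g A B c \<and> (\<lambda>k. (y k, z k, x k)) \<longlonglongrightarrow> ubar \<and>
        0 < \<eta> \<and> KKT_map_subregular p f q g A B c ubar \<eta>
        \<longrightarrow>
        (let dist2 = (\<lambda>k. (op_dist (Mop A B \<Sigma>f \<Sigma>g S T \<sigma> \<tau>) (y k, z k, x k)
                             (KKT_points p f q g A B c))\<^sup>2);
             zstep = (\<lambda>k. sqnorm (\<lambda>h. \<Sigma>g h + T h) (z k - z (k - 1)))
         in \<exists>\<mu>. 0 < \<mu> \<and> \<mu> < 1 \<and>
              (\<exists>k0\<ge>1. \<forall>k\<ge>k0.
                 dist2 (k + 1) + zstep (k + 1) \<le> \<mu> * (dist2 k + zstep k)) \<and>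
              (\<exists>\<mu>hat. \<mu> \<le> \<mu>hat \<and> \<mu>hat < 1 \<and>
                 (\<forall>k\<ge>1. dist2 (k + 1) + zstep (k + 1) \<le> \<mu>hat * (dist2 k + zstep k)))))"
proof -
  interpret majorized_ipadmm p f q g A B c \<Sigma>f S \<Sigma>g T \<sigma> \<tau> y z x
    by (rule majorized_ipadmm.intro) (fact assms)+
  show ?thesis
    unfolding Let_def
    using optimal_limit linear_rate[unfolded merit_def] by blast
qed

end
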